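(* Let $\mathbf A\in\mathbb R^{m\times n}$ be nonzero with rank $r$ and let $\mathbf b\in\mathbb R^m$ (the linear system $\mathbf A\mathbf x=\mathbf b$ may be consistent or inconsistent). Let $\mathbf x^k$ be the $k$th iterate of the REBK algorithm (defined in the context) with $\mathbf z^0\in\mathbf b+\mathrm{ran}(\mathbf A)$ and $\mathbf x^0\in\mathrm{ran}(\mathbf A^{T})$. Assume that $0<\alpha<2/\max(\beta_{\max}^{\mathcal I},\beta_{\max}^{\mathcal J})$. Then for any $\varepsilon>0$ and every $k\ge 0$, $$\mathbb E\big[\|\mathbf x^k-\mathbf A^\dagger\mathbf b\|_2^2\big]\le(1+\varepsilon)^k\eta^k\|\mathbf x^0-\mathbf A^\dagger\mathbf b\|_2^2+\Big(1+\frac1\varepsilon\Big)\frac{\alpha^2\beta_{\max}^{\mathcal I}\|\mathbf z^0-\mathbf b_\perp\|_2^2}{\|\mathbf A\|_F^2}\sum_{l=0}^{k-1}\rho^{k-l}(1+\varepsilon)^l\eta^l .$$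
   Context: Notation: $[m]=\{1,\dots,m\}$. $\mathbf A^\dagger$ is the Moore-Penrose pseudoinverse, $\mathrm{ran}(\cdot)$ the column space, $\|\cdot\|_F$ the Frobenius norm; $\|\cdot\|_2$ is the Euclidean norm of a vector and the spectral norm of a matrix. $\sigma_1(\mathbf A)\ge\dots\ge\sigma_r(\mathbf A)>0$ are the nonzero singular values of $\mathbf A$, $r=\mathrm{rank}(\mathbf A)$. For index sets $\mathcal I\subseteq[m]$, $\mathcal J\subseteq[n]$, $\mathbf A_{\mathcal I,:}$ and $\mathbf A_{:,\mathcal J}$ are the row submatrix indexed by $\mathcal I$ and the column submatrix indexed by $\mathcal J$; $\mathbf b_{\mathcal I}$, $\mathbf z_{\mathcal I}$ are the corresponding subvectors. $\mathbf b_\perp:=(\mathbf I-\mathbf A\mathbf A^\dagger)\mathbf b$. REBK algorithm (randomized extended block Kaczmarz): Let $\{\mathcal I_1,\dots,\mathcal I_s\}$ and $\{\mathcal J_1,\dots,\mathcal J_t\}$ be partitions of $[m]$ and $[n]$ respectively (pairwise disjoint sets with the given union), such that every block $\mathbf A_{\mathcal I_i,:}$ and $\mathbf A_{:,\mathcal J_j}$ is nonzero, and let $\alpha>0$. Given deterministic initial vectors $\mathbf z^0\in\mathbb R^m$, $\mathbf x^0\in\mathbb R^n$, for $k=1,2,\dots$: (1) pick $j\in[t]$ with probability $\|\mathbf A_{:,\mathcal J_j}\|_F^2/\|\mathbf A\|_F^2$ and set $\mathbf z^k=\mathbf z^{k-1}-\frac{\alpha}{\|\mathbf A_{:,\mathcal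 J_j}\|_F^2}\mathbf A_{:,\mathcal J_j}(\mathbf A_{:,\mathcal J_j})^{T}\mathbf z^{k-1}$; (2) pick $i\in[s]$ with probability $\|\mathbf A_{\mathcal I_i,:}\|_F^2/\|\mathbf A\|_F^2$ and set $\mathbf x^k=\mathbf x^{k-1}-\frac{\alpha}{\|\mathbf A_{\mathcal I_i,:}\|_F^2}(\mathbf A_{\mathcal I_i,:})^{T}(\mathbf A_{\mathcal I_i,:}\mathbf x^{k-1}-\mathbf b_{\mathcal I_i}+\mathbf z^k_{\mathcal I_i})$. All random picks (over all iterations, rows and columns) are mutually independent. $\mathbb E$ is expectation with respect to these picks. Constants: $$\beta_{\max}^{\mathcal I}:=\max_{i\in[s]}\frac{\|\mathbf A_{\mathcal I_i,:}\|_2^2}{\|\mathbf A_{\mathcal I_i,:}\|_F^2},\qquad \beta_{\max}^{\mathcal J}:=\max_{j\in[t]}\frac{\|\mathbf A_{:,\mathcal J_j}\|_2^2}{\|\mathbf A_{:,\mathcal J_j}\|_F^2},$$ $$\eta:=1-\frac{(2\alpha-\alpha^2\beta_{\max}^{\mathcal I})\sigma_r^2(\mathbf A)}{\|\mathbf A\|_F^2},\qquad \rho:=1-\frac{(2\alpha-\alpha^2\beta_{\max}^{\mathcal J})\sigma_r^2(\mathbf A)}{\|\mathbf A\|_F^2}.$$ *)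

theory Defs
  imports "HOL-Probability.Probability"
begin

text \<open>
  The row index set \<open>[m]\<close> and the column index set \<open>[n]\<close> are the finite types \<open>'m\<close> and \<open>'n\<close>.
  The Frobenius norm is the library's \<^term>\<open>norm :: real^'n^'m \<Rightarrow> real\<close> (the \<open>\<ell>\<^sub>2\<close> norm of the
  entries), the spectral norm is \<^term>\<open>onorm\<close> of the induced linear map.
\<close>

subsection \<open>Linear algebra\<close>

text \<open>
  Submatrices and subvectors keep their ambient index type: the entries outside the block
  are set to zero. This changes neither norm of a block, nor products such as
  \<open>(A\<^sub>I\<^sub>,\<^sub>:)\<^sup>T (A\<^sub>I\<^sub>,\<^sub>: x - b\<^sub>I + z\<^sub>I)\<close> and \<open>A\<^sub>:\<^sub>,\<^sub>J (A\<^sub>:\<^sub>,\<^sub>J)\<^sup>T z\<close>, in which the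
  additional coordinates contribute zero.
\<close>

definition row_block :: "real^'n^'m \<Rightarrow> 'm set \<Rightarrow> real^'n^'m" where
  "row_block A S = (\<chi> i j. if i \<in> S then A $ i $ j else 0)"

definition col_block :: "real^'n^'m \<Rightarrow> 'n set \<Rightarrow> real^'n^'m" where
  "col_block A S = (\<chi> i j. if j \<in> S then A $ i $ j else 0)"

definition subvec :: "real^'m \<Rightarrow> 'm set \<Rightarrow> real^'m" where
  "subvec v S = (\<chi> i. if i \<in> S then v $ i else 0)"

abbreviation spectral_norm :: "real^'n^'m \<Rightarrow> real" where
  "spectral_norm A \<equiv> onorm ((*v) A)"

abbreviation frobenius_norm :: "real^'n^'m \<Rightarrow> real" where
  "frobenius_norm A \<equiv> norm A"

definition col_space :: "real^'n^'m \<Rightarrow> (real^'m) set" where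
  "col_space A = span (columns A)"

definition is_pinv :: "real^'n^'m \<Rightarrow> real^'m^'n \<Rightarrow> bool" where
  "is_pinv A X \<longleftrightarrow> A ** X ** A = A \<and> X ** A ** X = X \<and>
     transpose (A ** X) = A ** X \<and> transpose (X ** A) = X ** A"

definition pinv :: "real^'n^'m \<Rightarrow> real^'m^'n" where
  "pinv A = (THE X. is_pinv A X)"

definition nonzero_singular_values :: "real^'n^'m \<Rightarrow> real set" where
  "nonzero_singular_values A =
     {\<sigma>. \<sigma> > 0 \<and> (\<exists>v. v \<noteq> 0 \<and> (transpose A ** A) *v v = \<sigma>\<^sup>2 *\<^sub>R v)}"

text \<open>\<open>\<sigma>\<^sub>r(A)\<close> with \<open>r = rank A\<close>: the last of the nonzero singular values in decreasing order.\<close>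

definition smallest_singular_value :: "real^'n^'m \<Rightarrow> real" where
  "smallest_singular_value A = Min (nonzero_singular_values A)"

definition b_perp :: "real^'n^'m \<Rightarrow> real^'m \<Rightarrow> real^'m" where
  "b_perp A b = (mat 1 - A ** pinv A) *v b"

subsection \<open>The algorithm\<close>

definition block_partition :: "nat \<Rightarrow> (nat \<Rightarrow> 'k set) \<Rightarrow> bool" where
  "block_partition s I \<longleftrightarrow> disjoint_family_on I {1..s} \<and> (\<Union>i\<in>{1..s}. I i) = UNIV"

text \<open>
  The iterates are functions of the sequences \<open>js\<close>, \<open>is\<close> of picked block indices; the
  \<open>k\<close>-th iteration (\<open>k \<ge> 1\<close>) uses \<open>js k\<close> and \<open>is k\<close>.
\<close>

primrec rebk_z :: "real^'n^'m \<Rightarrow> (nat \<Rightarrow> 'n set) \<Rightarrow> real \<Rightarrow> real^'m \<Rightarrow> (nat \<Rightarrow> nat) \<Rightarrow> nat \<Rightarrow> real^'m"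
where
  "rebk_z A J \<alpha> z0 js 0 = z0"
| "rebk_z A J \<alpha> z0 js (Suc k) =
     (let z = rebk_z A J \<alpha> z0 js k; B = col_block A (J (js (Suc k)))
      in z - (\<alpha> / (frobenius_norm B)\<^sup>2) *\<^sub>R (B *v (transpose B *v z)))"

primrec rebk_x :: "real^'n^'m \<Rightarrow> real^'m \<Rightarrow> (nat \<Rightarrow> 'm set) \<Rightarrow> (nat \<Rightarrow> 'n set) \<Rightarrow> real \<Rightarrow>
  real^'m \<Rightarrow> real^'n \<Rightarrow> (nat \<Rightarrow> nat) \<Rightarrow> (nat \<Rightarrow> nat) \<Rightarrow> nat \<Rightarrow> real^'n"
where
  "rebk_x A b I J \<alpha> z0 x0 js is 0 = x0"
| "rebk_x A b I J \<alpha> z0 x0 js is (Suc k) =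
     (let x = rebk_x A b I J \<alpha> z0 x0 js is k;
          z = rebk_z A J \<alpha> z0 js (Suc k);
          S = I (is (Suc k)); B = row_block A S
      in x - (\<alpha> / (frobenius_norm B)\<^sup>2) *\<^sub>R
              (transpose B *v (B *v x - subvec b S + subvec z S)))"

text \<open>
  The picks in the iterations \<open>1, 2, \<dots>\<close>: \<open>jpick k\<close> and \<open>ipick k\<close> have the prescribed
  distributions, and all of them (columns and rows together) are mutually independent.
\<close>

definition rebk_picks :: "'w measure \<Rightarrow> real^'n^'m \<Rightarrow> nat \<Rightarrow> (nat \<Rightarrow> 'm set) \<Rightarrow>
  nat \<Rightarrow> (nat \<Rightarrow> 'n set) \<Rightarrow> (nat \<Rightarrow> 'w \<Rightarrow> nat) \<Rightarrow> (nat \<Rightarrow> 'w \<Rightarrow> nat) \<Rightarrow> bool" where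
  "rebk_picks M A s I t J jpick ipick \<longleftrightarrow>
     prob_space.indep_vars M (\<lambda>_. count_space UNIV) (case_sum jpick ipick) ({1..} <+> {1..}) \<and>
     (\<forall>k\<ge>1. \<forall>j\<in>{1..t}. measure M {\<omega> \<in> space M. jpick k \<omega> = j} =
        (frobenius_norm (col_block A (J j)))\<^sup>2 / (frobenius_norm A)\<^sup>2) \<and>
     (\<forall>k\<ge>1. \<forall>i\<in>{1..s}. measure M {\<omega> \<in> space M. ipick k \<omega> = i} =
        (frobenius_norm (row_block A (I i)))\<^sup>2 / (frobenius_norm A)\<^sup>2)"

subsection \<open>Constants\<close>

definition beta_row :: "real^'n^'m \<Rightarrow> nat \<Rightarrow> (nat \<Rightarrow> 'm set) \<Rightarrow> real" where
  "beta_row A s I = Max ((\<lambda>i. (spectral_norm (row_block A (I i)))\<^sup>2 /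
     (frobenius_norm (row_block A (I i)))\<^sup>2) ` {1..s})"

definition beta_col :: "real^'n^'m \<Rightarrow> nat \<Rightarrow> (nat \<Rightarrow> 'n set) \<Rightarrow> real" where
  "beta_col A t J = Max ((\<lambda>j. (spectral_norm (col_block A (J j)))\<^sup>2 /
     (frobenius_norm (col_block A (J j)))\<^sup>2) ` {1..t})"

definition rebk_eta :: "real^'n^'m \<Rightarrow> nat \<Rightarrow> (nat \<Rightarrow> 'm set) \<Rightarrow> real \<Rightarrow> real" where
  "rebk_eta A s I \<alpha> =
     1 - (2 * \<alpha> - \<alpha>\<^sup>2 * beta_row A s I) * (smallest_singular_value A)\<^sup>2 / (frobenius_norm A)\<^sup>2"

definition rebk_rho :: "real^'n^'m \<Rightarrow> nat \<Rightarrow> (nat \<Rightarrow> 'n set) \<Rightarrow> real \<Rightarrow> real" where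
  "rebk_rho A t J \<alpha> =
     1 - (2 * \<alpha> - \<alpha>\<^sup>2 * beta_col A t J) * (smallest_singular_value A)\<^sup>2 / (frobenius_norm A)\<^sup>2"

subsection \<open>The pseudoinverse is well defined\<close>

lemma inner_matrix_transpose: "(A *v x) \<bullet> y = x \<bullet> (transpose A *v y)"
  for A :: "real^'n^'m"
  by (metis dot_lmul_matrix inner_commute vector_transpose_matrix transpose_transpose)

lemma is_pinv_unique:
  assumes X: "is_pinv A X" and Y: "is_pinv A Y"
  shows "X = Y"
proof -
  have AX: "A ** X = A ** Y"
  proof -
    have "A ** X = transpose (A ** X)" using X by (simp add: is_pinv_def)
    also have "\<dots> = transpose ((A ** Y) ** (A ** X))"
      using Y by (simp add: is_pinv_def matrix_mul_assoc)
    also have "\<dots> = (A ** X) ** (A ** Y)"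
      using X Y by (simp only: is_pinv_def matrix_transpose_mul)
    also have "\<dots> = A ** Y" using X by (simp add: is_pinv_def matrix_mul_assoc)
    finally show ?thesis .
  qed
  have XA: "X ** A = Y ** A"
  proof -
    have "X ** A = transpose (X ** A)" using X by (simp add: is_pinv_def)
    also have "\<dots> = transpose ((X ** A) ** (Y ** A))"
      using Y by (metis is_pinv_def matrix_mul_assoc)
    also have "\<dots> = (Y ** A) ** (X ** A)"
      using X Y by (simp only: is_pinv_def matrix_transpose_mul)
    also have "\<dots> = Y ** A" using X by (metis is_pinv_def matrix_mul_assoc)
    finally show ?thesis .
  qed
  have "X = X ** (A ** X)" using X by (simp add: is_pinv_def matrix_mul_assoc)
  also have "\<dots> = Y ** A ** Y" by (simp add: AX matrix_mul_assoc XA)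
  also have "\<dots> = Y" using Y by (simp add: is_pinv_def)
  finally show ?thesis .
qed

lemma is_pinv_exists:
  fixes A :: "real^'n^'m"
  shows "\<exists>X. is_pinv A X"
proof -
  note transpose_matrix_vector [simp del]
  let ?T = "transpose A"
  have sub: "subspace (range ((*v) B))" for B :: "real^'a^'b"
    by (intro linear_subspace_image matrix_vector_mul_linear subspace_UNIV)
  have decomp: "\<exists>u. \<forall>w. orthogonal (x - B *v u) (B *v w)" for B :: "real^'a^'b" and x
  proof -
    obtain y z where "y \<in> span (range ((*v) B))"
      and z: "\<And>w. w \<in> span (range ((*v) B)) \<Longrightarrow> orthogonal z w" and x: "x = y + z"
      using orthogonal_subspace_decomp_exists by blast
    then have "y \<in> range ((*v) B)" using sub[of B] by (simp add: span_eq_iff[THEN iffD2])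
    then obtain u where "y = B *v u" by blast
    with x have "x - B *v u = z" by simp
    then show ?thesis using z by (metis rangeI span_base)
  qed
  have ker: "A *v n = 0" if "\<And>w. orthogonal n (?T *v w)" for n
    using that[of "A *v n"] inner_matrix_transpose[of A n "A *v n"] by (simp add: orthogonal_def)
  have "\<exists>v. \<forall>w. orthogonal (y - A *v (?T *v v)) (A *v w)" for y
  proof -
    obtain u where u: "\<And>w. orthogonal (y - A *v u) (A *v w)" using decomp by blast
    obtain v where "\<And>w. orthogonal (u - ?T *v v) (?T *v w)" using decomp by blast
    then have "A *v (u - ?T *v v) = 0" by (rule ker)
    then have "A *v u = A *v (?T *v v)" by (simp add: matrix_vector_mult_diff_distrib)
    with u show ?thesis by metis
  qed
  then obtain h where h: "\<And>y w. orthogonal (y - A *v (?T *v h y)) (A *v w)" by metis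
  define g where "g y = ?T *v h y" for y
  have g_orth: "orthogonal (y - A *v g y) (A *v w)" for y w using h by (simp add: g_def)
  have uniq: "g y = ?T *v v" if "\<And>w. orthogonal (y - A *v (?T *v v)) (A *v w)" for y v
  proof -
    let ?d = "?T *v (h y - v)"
    have d: "g y - ?T *v v = ?d" by (simp add: g_def matrix_vector_mult_diff_distrib)
    have "orthogonal (A *v ?d) (A *v w)" for w
    proof -
      have "A *v ?d = (y - A *v (?T *v v)) - (y - A *v g y)"
        unfolding d[symmetric] by (simp add: matrix_vector_mult_diff_distrib)
      then show ?thesis using that[of w] g_orth[of y w] by (simp add: orthogonal_def inner_diff_left)
    qed
    then have "A *v ?d = 0" by (simp add: orthogonal_def) (metis inner_eq_zero_iff)
    then have "?d \<bullet> ?d = 0"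
      by (metis inner_matrix_transpose transpose_transpose inner_zero_right)
    then show ?thesis using d by simp
  qed
  have lin: "linear g"
  proof (rule linearI)
    fix x y
    have "g (x + y) = ?T *v (h x + h y)"
    proof (rule uniq)
      fix w
      have "x + y - A *v (?T *v (h x + h y)) = (x - A *v g x) + (y - A *v g y)"
        by (simp add: g_def matrix_vector_right_distrib)
      then show "orthogonal (x + y - A *v (?T *v (h x + h y))) (A *v w)"
        using g_orth[of x w] g_orth[of y w] by (simp only: orthogonal_def inner_add_left)
    qed
    then show "g (x + y) = g x + g y" by (simp add: g_def matrix_vector_right_distrib)
  next
    fix c x
    have "g (c *\<^sub>R x) = ?T *v (c *\<^sub>R h x)"
    proof (rule uniq)
      fix w
      have "c *\<^sub>R x - A *v (?T *v (c *\<^sub>R h x)) = c *\<^sub>R (x - A *v g x)"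
        by (simp add: g_def matrix_vector_mult_scaleR scaleR_diff_right)
      then show "orthogonal (c *\<^sub>R x - A *v (?T *v (c *\<^sub>R h x))) (A *v w)"
        using g_orth[of x w] by (simp only: orthogonal_def inner_scaleR_left mult_zero_right)
    qed
    then show "g (c *\<^sub>R x) = c *\<^sub>R g x" by (simp add: g_def matrix_vector_mult_scaleR)
  qed
  define X where "X = matrix g"
  have X: "X *v y = g y" for y using lin by (simp add: X_def matrix_works linear_matrix_vector_mul_eq)
  have gA: "A *v g (A *v x) = A *v x" for x
  proof -
    have "orthogonal (A *v x - A *v g (A *v x)) (A *v (x - g (A *v x)))" by (rule g_orth)
    then show ?thesis by (simp add: matrix_vector_mult_diff_distrib orthogonal_def)
  qed
  have sym: "transpose B = B" if "\<And>x y. (B *v x) \<bullet> y = x \<bullet> (B *v y)" for B :: "real^'a^'a"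
  proof -
    have "x \<bullet> (transpose B *v y) = x \<bullet> (B *v y)" for x y
      using that inner_matrix_transpose[of B x y] by simp
    then show ?thesis by (simp add: matrix_eq) (metis vector_eq_ldot)
  qed
  have 1: "A ** X ** A = A"
    by (simp add: matrix_eq X gA flip: matrix_vector_mul_assoc)
  have 2: "X ** A ** X = X"
  proof -
    have "g (A *v g y) = g y" for y
      unfolding g_def[of y] by (rule uniq) (simp add: orthogonal_def)
    then show ?thesis by (simp add: matrix_eq X flip: matrix_vector_mul_assoc)
  qed
  have 3: "transpose (A ** X) = A ** X"
  proof (rule sym)
    fix x y
    have "(A *v g x) \<bullet> (y - A *v g y) = 0" "(x - A *v g x) \<bullet> (A *v g y) = 0"
      using g_orth by (auto simp: orthogonal_def inner_commute)
    then show "(A ** X *v x) \<bullet> y = x \<bullet> (A ** X *v y)"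
      by (simp add: X inner_diff_left inner_diff_right flip: matrix_vector_mul_assoc)
  qed
  have 4: "transpose (X ** A) = X ** A"
  proof (rule sym)
    fix x y
    have *: "g (A *v a) \<bullet> (b - g (A *v b)) = 0" for a b
    proof -
      have "A *v (b - g (A *v b)) = 0" by (simp add: gA matrix_vector_mult_diff_distrib)
      then show ?thesis
        unfolding g_def[of "A *v a"]
        by (metis inner_matrix_transpose transpose_transpose inner_zero_right)
    qed
    show "(X ** A *v x) \<bullet> y = x \<bullet> (X ** A *v y)"
      using *[of x y] *[of y x]
      by (simp add: X inner_diff_right inner_commute flip: matrix_vector_mul_assoc)
  qed
  show ?thesis using 1 2 3 4 unfolding is_pinv_def by blast
qed

lemma is_pinv_pinv: "is_pinv A (pinv A)"
  unfolding pinv_def by (rule theI') (metis is_pinv_exists is_pinv_unique)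

end

theory Submission
  imports Defs
begin

text \<open>
  Write \<open>u\<^sub>k = z\<^sup>k - b\<^sub>\<bottom>\<close> and \<open>e\<^sub>k = x\<^sup>k - A\<^sup>\<dagger>b\<close>. Since \<open>A\<^sup>T b\<^sub>\<bottom> = 0\<close> and
  \<open>A A\<^sup>\<dagger> b = b - b\<^sub>\<bottom>\<close>, both errors obey recursions in which \<open>b\<close> no longer occurs. With the
  homogeneous step \<open>v \<mapsto> v - (\<alpha> / \<parallel>R\<parallel>\<^sub>F\<^sup>2) R\<^sup>T R v\<close> for a row block \<open>R\<close> of a matrix
  (\<open>block_step\<close>), \<open>u\<^sub>k\<close> evolves by such steps for \<open>A\<^sup>T\<close>, whose row blocks are the transposed column
  blocks of \<open>A\<close>, and \<open>e\<^sub>k\<close> evolves by such steps for \<open>A\<close>, perturbed by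
  \<open>(\<alpha> / \<parallel>R\<parallel>\<^sub>F\<^sup>2) A\<^sup>T (u\<^sub>k\<^sub>+\<^sub>1)\<^sub>I\<close>. Thus a single contraction estimate serves both halves of
  the algorithm, and \<open>\<rho>\<close> is the rate \<open>\<eta>\<close> of the transposed matrix.

  \<^bold>\<open>Contraction.\<close> Expanding the square of one step gives
  \<open>\<parallel>v\<parallel>\<^sup>2 - 2 c \<parallel>R v\<parallel>\<^sup>2 + c\<^sup>2 \<parallel>R\<^sup>T R v\<parallel>\<^sup>2\<close> with \<open>c = \<alpha> / \<parallel>R\<parallel>\<^sub>F\<^sup>2\<close>. The last term is at most
  \<open>c\<^sup>2 \<beta> \<parallel>R\<parallel>\<^sub>F\<^sup>2 \<parallel>R v\<parallel>\<^sup>2\<close>, and the sampling weight \<open>\<parallel>R\<parallel>\<^sub>F\<^sup>2 / \<parallel>A\<parallel>\<^sub>F\<^sup>2\<close> cancels the remaining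
  denominator. As the blocks partition the rows, the terms \<open>\<parallel>R v\<parallel>\<^sup>2\<close> add up to \<open>\<parallel>A v\<parallel>\<^sup>2\<close>, so
  the mean is at most \<open>\<parallel>v\<parallel>\<^sup>2 - (2 \<alpha> - \<alpha>\<^sup>2 \<beta>) \<parallel>A v\<parallel>\<^sup>2 / \<parallel>A\<parallel>\<^sub>F\<^sup>2\<close>
  (\<open>block_step_contraction\<close>). On the row space \<open>\<parallel>A v\<parallel> \<ge> \<sigma>\<^sub>r \<parallel>v\<parallel>\<close>
  (\<open>smallest_singular_value_bound\<close>), and the errors never leave the range of \<open>A\<close>,
  respectively of \<open>A\<^sup>T\<close>, because every correction lies in it.

  \<^bold>\<open>Recursion.\<close> The inequality
  \<open>\<parallel>x - y\<parallel>\<^sup>2 \<le> (1 + \<epsilon>) \<parallel>x\<parallel>\<^sup>2 + (1 + 1/\<epsilon>) \<parallel>y\<parallel>\<^sup>2\<close> separates the contraction of \<open>e\<^sub>k\<close> from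
  the perturbation, whose mean square is at most \<open>\<alpha>\<^sup>2 \<beta> \<parallel>u\<^sub>k\<^sub>+\<^sub>1\<parallel>\<^sup>2 / \<parallel>A\<parallel>\<^sub>F\<^sup>2\<close>
  (\<open>noisy_block_step_contraction\<close>). Hence
  \<open>E \<parallel>e\<^sub>k\<^sub>+\<^sub>1\<parallel>\<^sup>2 \<le> (1 + \<epsilon>) \<eta> E \<parallel>e\<^sub>k\<parallel>\<^sup>2 + (1 + 1/\<epsilon>) (\<alpha>\<^sup>2 \<beta> / \<parallel>A\<parallel>\<^sub>F\<^sup>2) \<rho>\<^sup>k\<^sup>+\<^sup>1 \<parallel>u\<^sub>0\<parallel>\<^sup>2\<close>,
  and unrolling this recursion gives the bound.

  \<^bold>\<open>Probability.\<close> A pick is independent of the iterates computed before it, which are functions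
  of the earlier picks. By Fubini the expectation after the pick is therefore the expectation of
  the mean over the blocks (\<open>nn_integral_fresh_pick_le\<close>), to which the contraction estimates
  apply pointwise. All expectations are taken as nonnegative integrals, so that the integrability
  of the squared errors never has to be discussed.
\<close>

text \<open>
  The simplification rule \<open>transpose_matrix_vector\<close> turns \<open>A\<^sup>T v\<close> into a product \<open>v A\<close>. It would
  destroy the symmetry between \<open>A\<close> and \<open>A\<^sup>T\<close> on which the proof rests.
\<close>

declare transpose_matrix_vector [simp del]

section \<open>Blocks of matrices and vectors\<close>

lemma sum_block_partition:
  fixes c :: "'a::comm_monoid_add"
  assumes "block_partition s I"
  shows "(\<Sum>i=1..s. if x \<in> I i then c else 0) = c"
proof -
  have disj: "disjoint_family_on I {1..s}" and cov: "(\<Union>i\<in>{1..s}. I i) = UNIV"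
    using assms by (auto simp: block_partition_def)
  obtain i0 where i0: "i0 \<in> {1..s}" "x \<in> I i0" using cov by (metis UNIV_I UN_iff)
  have "x \<in> I i \<longleftrightarrow> i = i0" if "i \<in> {1..s}" for i
    using disj i0 that unfolding disjoint_family_on_def by blast
  then have "(\<Sum>i=1..s. if x \<in> I i then c else 0) = (\<Sum>i=1..s. if i = i0 then c else 0)"
    by (intro sum.cong) auto
  also have "\<dots> = c" using i0 by simp
  finally show ?thesis .
qed

lemma norm_vec_sq: "(norm v)\<^sup>2 = (\<Sum>x\<in>UNIV. (norm (v $ x))\<^sup>2)"
  for v :: "'b::real_inner^'m"
  by (simp add: power2_norm_eq_inner inner_vec_def)

text \<open>
  The entries may lie in any inner product space, so that the lemma applies to vectors (real
  entries) and to matrices (whose entries are their rows) alike.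
\<close>

lemma sum_norm_sq_blocks:
  fixes v :: "'b::real_inner^'m"
  assumes "block_partition s I"
  shows "(\<Sum>i=1..s. (norm (\<chi> x. if x \<in> I i then v $ x else 0))\<^sup>2) = (norm v)\<^sup>2"
proof -
  have "(\<Sum>i=1..s. (norm (\<chi> x. if x \<in> I i then v $ x else 0))\<^sup>2)
      = (\<Sum>i=1..s. \<Sum>x\<in>UNIV. if x \<in> I i then (norm (v $ x))\<^sup>2 else 0)"
    unfolding norm_vec_sq by (intro sum.cong) auto
  also have "\<dots> = (\<Sum>x\<in>UNIV. \<Sum>i=1..s. if x \<in> I i then (norm (v $ x))\<^sup>2 else 0)"
    by (rule sum.swap)
  also have "\<dots> = (norm v)\<^sup>2"
    by (simp only: sum_block_partition[OF assms] norm_vec_sq)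
  finally show ?thesis .
qed

lemma sum_norm_sq_row_block:
  assumes "block_partition s I"
  shows "(\<Sum>i=1..s. (norm (row_block A (I i)))\<^sup>2) = (norm A)\<^sup>2"
proof -
  have "row_block A S = (\<chi> x. if x \<in> S then A $ x else 0)" for S
    by (simp add: row_block_def vec_eq_iff)
  then show ?thesis using sum_norm_sq_blocks[OF assms, of A] by simp
qed

lemma sum_norm_sq_subvec:
  assumes "block_partition s I"
  shows "(\<Sum>i=1..s. (norm (subvec v (I i)))\<^sup>2) = (norm v)\<^sup>2"
  using sum_norm_sq_blocks[OF assms, of v] by (simp add: subvec_def)

lemma row_block_mult_vec: "row_block A S *v v = subvec (A *v v) S"
  by (simp add: row_block_def subvec_def vec_eq_iff matrix_vector_mult_def)

lemma transpose_row_block_mult_vec: "transpose (row_block A S) *v u = transpose A *v subvec u S"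
  by (auto simp: row_block_def subvec_def vec_eq_iff matrix_vector_mult_def transpose_def
      intro!: sum.cong)

lemma subvec_diff: "subvec (u - v) S = subvec u S - subvec v S"
  by (simp add: subvec_def vec_eq_iff)

text \<open>
  Through this identity every statement about column blocks is one about the row blocks of
  \<open>A\<^sup>T\<close>.
\<close>

lemma col_block_eq_transpose: "col_block A S = transpose (row_block (transpose A) S)"
  by (simp add: col_block_def row_block_def transpose_def vec_eq_iff)

lemma norm_transpose: "norm (transpose A) = norm A"
  for A :: "real^'n^'m"
proof -
  have "(norm (transpose A))\<^sup>2 = (norm A)\<^sup>2"
    unfolding norm_vec_sq by (simp add: transpose_def) (rule sum.swap)
  then show ?thesis by simp
qed

section \<open>Norms and the column space\<close>

lemma norm_sq_diff_scaleR:
  "(norm (x - c *\<^sub>R y))\<^sup>2 = (norm x)\<^sup>2 - 2 * c * (x \<bullet> y) + c\<^sup>2 * (norm y)\<^sup>2"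
  for x y :: "'b::real_inner"
  unfolding power2_norm_eq_inner
  by (simp add: inner_diff inner_commute algebra_simps power2_eq_square)

lemma norm_mult_vec_le: "norm (A *v v) \<le> onorm ((*v) A) * norm v"
  for A :: "real^'n^'m"
  by (intro onorm matrix_vector_mul_bounded_linear)

text \<open>
  With \<open>w = A\<^sup>T u\<close> one has \<open>\<parallel>w\<parallel>\<^sup>2 = A w \<bullet> u \<le> \<parallel>A\<parallel>\<^sub>2 \<parallel>w\<parallel> \<parallel>u\<parallel>\<close>; divide by
  \<open>\<parallel>w\<parallel>\<close>.
\<close>

lemma norm_transpose_mult_vec_le: "norm (transpose A *v u) \<le> onorm ((*v) A) * norm u"
  for A :: "real^'n^'m"
proof (cases "transpose A *v u = 0")
  case False
  let ?w = "transpose A *v u"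
  have "norm ?w * norm ?w = (A *v ?w) \<bullet> u"
    by (simp only: inner_matrix_transpose dot_square_norm power2_eq_square)
  also have "\<dots> \<le> norm (A *v ?w) * norm u" by (rule norm_cauchy_schwarz)
  also have "\<dots> \<le> (onorm ((*v) A) * norm ?w) * norm u"
    by (intro mult_right_mono norm_mult_vec_le) auto
  finally show ?thesis using False by (simp add: mult.assoc mult.left_commute)
next
  case True
  then show ?thesis
    using onorm_pos_le[OF matrix_vector_mul_bounded_linear[of A]] by simp
qed

lemma onorm_transpose: "onorm ((*v) (transpose A)) = onorm ((*v) A)"
  for A :: "real^'n^'m"
proof -
  have "onorm ((*v) (transpose B)) \<le> onorm ((*v) B)" for B :: "real^'a^'b"
    by (intro onorm_le norm_transpose_mult_vec_le)
  from this[of A] this[of "transpose A"] show ?thesis by simp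
qed

lemma col_space_eq_range: "col_space A = range ((*v) A)"
proof
  show "range ((*v) A) \<subseteq> col_space A"
    by (auto simp: col_space_def matrix_vector_mult_in_columnspace)
  have "subspace (range ((*v) A))"
    by (intro linear_subspace_image matrix_vector_mul_linear subspace_UNIV)
  moreover have "columns A \<subseteq> range ((*v) A)"
    unfolding columns_image_basis by auto
  ultimately show "col_space A \<subseteq> range ((*v) A)"
    unfolding col_space_def by (intro span_minimal)
qed

lemma subspace_col_space: "subspace (col_space A)"
  by (simp add: col_space_def)

lemma mult_vec_in_col_space: "A *v v \<in> col_space A"
  by (simp add: col_space_eq_range)

lemma gram_eq_0D:
  fixes A :: "real^'n^'m"
  assumes "transpose A *v (A *v v) = 0"
  shows "A *v v = 0"
  by (metis assms inner_eq_zero_iff inner_matrix_transpose inner_zero_right)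

text \<open>
  The row space is the orthogonal complement of the kernel. This is what makes the least gain on
  the row space positive.
\<close>

lemma mult_vec_eq_0_on_row_space:
  fixes A :: "real^'n^'m"
  assumes "v \<in> col_space (transpose A)" and "A *v v = 0"
  shows "v = 0"
proof -
  obtain u where "v = transpose A *v u" using assms(1) by (auto simp: col_space_eq_range)
  then show ?thesis using gram_eq_0D[of "transpose A" u] assms(2) by simp
qed

lemma transpose_mult_vec_ne_0:
  fixes A :: "real^'n^'m"
  assumes "A \<noteq> 0"
  obtains u where "transpose A *v u \<noteq> 0"
proof -
  have "transpose A \<noteq> 0" using assms by (metis norm_eq_zero norm_transpose)
  then obtain u where "transpose A *v u \<noteq> 0 *v u" by (metis matrix_eq)
  then show thesis using that by simp
qed

section \<open>The smallest singular value\<close>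

text \<open>
  Eigenvectors of \<open>A\<^sup>T A\<close> for distinct eigenvalues are orthogonal, hence linearly independent,
  and there is room for only finitely many of them. Finiteness is needed because the smallest
  singular value is defined as a minimum of a set.
\<close>

lemma finite_nonzero_singular_values: "finite (nonzero_singular_values A)"
  for A :: "real^'n^'m"
proof -
  let ?S = "nonzero_singular_values A"
  let ?G = "transpose A ** A"
  have "\<forall>\<sigma>\<in>?S. \<exists>v. v \<noteq> 0 \<and> ?G *v v = \<sigma>\<^sup>2 *\<^sub>R v"
    by (auto simp: nonzero_singular_values_def)
  then obtain e where e: "\<And>\<sigma>. \<sigma> \<in> ?S \<Longrightarrow> e \<sigma> \<noteq> 0 \<and> ?G *v e \<sigma> = \<sigma>\<^sup>2 *\<^sub>R e \<sigma>"
    by metis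
  have orth: "e \<sigma> \<bullet> e \<tau> = 0" if "\<sigma> \<in> ?S" "\<tau> \<in> ?S" "\<sigma> \<noteq> \<tau>" for \<sigma> \<tau>
  proof -
    have "\<sigma>\<^sup>2 * (e \<sigma> \<bullet> e \<tau>) = (?G *v e \<sigma>) \<bullet> e \<tau>" using e that by simp
    also have "\<dots> = e \<sigma> \<bullet> (?G *v e \<tau>)"
      by (simp add: inner_matrix_transpose matrix_transpose_mul)
    also have "\<dots> = \<tau>\<^sup>2 * (e \<sigma> \<bullet> e \<tau>)" using e that by simp
    finally have "(\<sigma>\<^sup>2 - \<tau>\<^sup>2) * (e \<sigma> \<bullet> e \<tau>) = 0" by (simp add: algebra_simps)
    moreover have "\<sigma>\<^sup>2 \<noteq> \<tau>\<^sup>2"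
      using that by (simp add: nonzero_singular_values_def power2_eq_iff)
    ultimately show ?thesis by simp
  qed
  have "independent (e ` ?S)"
    using e orth by (intro pairwise_orthogonal_independent)
      (auto simp: pairwise_def orthogonal_def)
  then have "finite (e ` ?S)" by (simp add: independent_imp_finite)
  moreover have "inj_on e ?S"
    using e orth by (intro inj_onI) (metis inner_eq_zero_iff)
  ultimately show ?thesis by (rule finite_imageD)
qed

text \<open>
  The Rayleigh quotient \<open>\<parallel>A v\<parallel>\<^sup>2 / \<parallel>v\<parallel>\<^sup>2\<close> attains its minimum \<open>\<mu>\<close> over the row space, and a
  minimiser is an eigenvector of \<open>A\<^sup>T A\<close> for \<open>\<mu>\<close>. This avoids the spectral theorem: it is the
  only eigenvector needed.
\<close>

lemma least_gain_is_singular_value: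
  fixes A :: "real^'n^'m"
  assumes "A \<noteq> 0"
  obtains \<mu> where "0 < \<mu>" "sqrt \<mu> \<in> nonzero_singular_values A"
    "\<And>v. v \<in> col_space (transpose A) \<Longrightarrow> \<mu> * (norm v)\<^sup>2 \<le> (norm (A *v v))\<^sup>2"
proof -
  let ?W = "col_space (transpose A)"
  have W: "subspace ?W" by (rule subspace_col_space)
  let ?K = "?W \<inter> sphere 0 1"
  obtain u where u: "transpose A *v u \<noteq> 0" using transpose_mult_vec_ne_0[OF assms] .
  have "(1 / norm (transpose A *v u)) *\<^sub>R (transpose A *v u) \<in> ?K"
    using u by (auto intro!: subspace_scale[OF W] mult_vec_in_col_space)
  then have "?K \<noteq> {}" by blast
  moreover have "compact ?K"
    by (intro closed_Int_compact closed_subspace W compact_sphere)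
  moreover have "continuous_on ?K (\<lambda>v. (norm (A *v v))\<^sup>2)"
    by (intro continuous_intros linear_continuous_on matrix_vector_mul_bounded_linear)
  ultimately obtain v0 where v0: "v0 \<in> ?K"
    and min: "\<And>v. v \<in> ?K \<Longrightarrow> (norm (A *v v0))\<^sup>2 \<le> (norm (A *v v))\<^sup>2"
    using continuous_attains_inf[of ?K "\<lambda>v. (norm (A *v v))\<^sup>2"] by blast
  define \<mu> where "\<mu> = (norm (A *v v0))\<^sup>2"
  have v0W: "v0 \<in> ?W" and v01: "norm v0 = 1" using v0 by auto
  then have "v0 \<noteq> 0" by auto
  then have "A *v v0 \<noteq> 0" using mult_vec_eq_0_on_row_space v0W by blast
  then have pos: "0 < \<mu>" by (simp add: \<mu>_def)
  have gain: "\<mu> * (norm v)\<^sup>2 \<le> (norm (A *v v))\<^sup>2" if "v \<in> ?W" for v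
  proof (cases "v = 0")
    case False
    have "(1 / norm v) *\<^sub>R v \<in> ?K" using False subspace_scale[OF W that] by auto
    from min[OF this] False show ?thesis
      by (simp add: \<mu>_def matrix_vector_mult_scaleR power_divide field_simps)
  qed simp
  \<comment> \<open>The form \<open>q\<close> is nonnegative on the row space and vanishes at the minimiser; \<open>g\<close> is half its gradient there.\<close>
  define q where "q v = (norm (A *v v))\<^sup>2 - \<mu> * (norm v)\<^sup>2" for v
  define g where "g = transpose A *v (A *v v0) - \<mu> *\<^sub>R v0"
  have gW: "g \<in> ?W" unfolding g_def
    by (intro subspace_diff[OF W] subspace_scale[OF W] v0W mult_vec_in_col_space)
  have "q v0 = 0" by (simp add: q_def \<mu>_def v01)
  have expand: "q (v0 - \<tau> *\<^sub>R g) = \<tau>\<^sup>2 * q g - 2 * \<tau> * (norm g)\<^sup>2" for \<tau>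
  proof -
    have "q (v0 - \<tau> *\<^sub>R g) = q v0 - 2 * \<tau> * ((A *v v0) \<bullet> (A *v g) - \<mu> * (v0 \<bullet> g)) + \<tau>\<^sup>2 * q g"
      unfolding q_def matrix_vector_mult_diff_distrib matrix_vector_mult_scaleR norm_sq_diff_scaleR
      by (simp add: algebra_simps)
    moreover have "(A *v v0) \<bullet> (A *v g) = (transpose A *v (A *v v0)) \<bullet> g"
      by (simp add: inner_matrix_transpose)
    then have "(A *v v0) \<bullet> (A *v g) - \<mu> * (v0 \<bullet> g)
      = (transpose A *v (A *v v0) - \<mu> *\<^sub>R v0) \<bullet> g"
      by (simp add: inner_diff_left)
    then have "(A *v v0) \<bullet> (A *v g) - \<mu> * (v0 \<bullet> g) = (norm g)\<^sup>2"
      by (simp add: power2_norm_eq_inner flip: g_def)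
    ultimately show ?thesis using \<open>q v0 = 0\<close> by simp
  qed
  have "g = 0"
  proof (rule ccontr)
    assume "g \<noteq> 0"
    then have n: "(norm g)\<^sup>2 > 0" by simp
    have nonneg: "0 \<le> q v" if "v \<in> ?W" for v using gain[OF that] by (simp add: q_def)
    \<comment> \<open>A step along \<open>-g\<close> this short makes \<open>q\<close> negative; the summand 1 covers \<open>q g = 0\<close>.\<close>
    define \<tau> where "\<tau> = (norm g)\<^sup>2 / (q g + 1)"
    have \<tau>: "0 < \<tau>" using n nonneg[OF gW] by (simp add: \<tau>_def)
    have "0 \<le> \<tau>\<^sup>2 * q g - 2 * \<tau> * (norm g)\<^sup>2"
      using nonneg expand v0W gW W by (metis subspace_diff subspace_scale)
    then have "0 \<le> \<tau> * (\<tau> * q g - 2 * (norm g)\<^sup>2)" by (simp add: power2_eq_square algebra_simps)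
    then have "2 * (norm g)\<^sup>2 \<le> \<tau> * q g" using \<tau> by (simp add: zero_le_mult_iff)
    also have "\<dots> \<le> \<tau> * (q g + 1)" using \<tau> by simp
    also have "\<dots> = (norm g)\<^sup>2" using nonneg[OF gW] by (simp add: \<tau>_def)
    finally show False using n by simp
  qed
  then have "(transpose A ** A) *v v0 = (sqrt \<mu>)\<^sup>2 *\<^sub>R v0"
    using pos by (simp add: g_def flip: matrix_vector_mul_assoc)
  then have "sqrt \<mu> \<in> nonzero_singular_values A"
    using pos \<open>v0 \<noteq> 0\<close> unfolding nonzero_singular_values_def by auto
  with pos gain show thesis by (intro that)
qed

lemma smallest_singular_value_bound:
  fixes A :: "real^'n^'m"
  assumes "A \<noteq> 0" "v \<in> col_space (transpose A)"
  shows "(smallest_singular_value A)\<^sup>2 * (norm v)\<^sup>2 \<le> (norm (A *v v))\<^sup>2"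
proof -
  obtain \<mu> where l: "0 < \<mu>" "sqrt \<mu> \<in> nonzero_singular_values A"
    "\<mu> * (norm v)\<^sup>2 \<le> (norm (A *v v))\<^sup>2"
    using least_gain_is_singular_value[OF assms(1)] assms(2) by metis
  have "smallest_singular_value A \<le> sqrt \<mu>"
    unfolding smallest_singular_value_def
    using l(2) finite_nonzero_singular_values by (intro Min_le)
  moreover have "smallest_singular_value A \<in> nonzero_singular_values A"
    unfolding smallest_singular_value_def
    using l(2) finite_nonzero_singular_values by (intro Min_in) auto
  then have "0 < smallest_singular_value A" by (simp add: nonzero_singular_values_def)
  ultimately have "(smallest_singular_value A)\<^sup>2 \<le> (sqrt \<mu>)\<^sup>2" by (intro power_mono) auto
  then have "(smallest_singular_value A)\<^sup>2 * (norm v)\<^sup>2 \<le> \<mu> * (norm v)\<^sup>2"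
    using l(1) by (intro mult_right_mono) auto
  with l(3) show ?thesis by simp
qed

text \<open>
  \<open>A\<close> maps eigenvectors of \<open>A\<^sup>T A\<close> to eigenvectors of \<open>A A\<^sup>T\<close> for the same nonzero eigenvalue.
\<close>

lemma smallest_singular_value_transpose:
  "smallest_singular_value (transpose A) = smallest_singular_value A"
  for A :: "real^'n^'m"
proof -
  have "nonzero_singular_values B \<subseteq> nonzero_singular_values (transpose B)" for B :: "real^'a^'b"
  proof
    fix \<sigma> assume "\<sigma> \<in> nonzero_singular_values B"
    then obtain v where v: "\<sigma> > 0" "v \<noteq> 0" "transpose B *v (B *v v) = \<sigma>\<^sup>2 *\<^sub>R v"
      by (auto simp: nonzero_singular_values_def matrix_vector_mul_assoc)
    have "B *v v \<noteq> 0" using v by (metis matrix_vector_mult_0_right power_eq_0_iff scaleR_eq_0_iff less_irrefl)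
    moreover have "B *v (transpose B *v (B *v v)) = \<sigma>\<^sup>2 *\<^sub>R (B *v v)"
      by (simp add: v(3) matrix_vector_mult_scaleR)
    ultimately show "\<sigma> \<in> nonzero_singular_values (transpose B)"
      using v(1) by (auto simp: nonzero_singular_values_def simp flip: matrix_vector_mul_assoc)
  qed
  from this[of A] this[of "transpose A"] show ?thesis
    by (simp add: smallest_singular_value_def subset_antisym)
qed

section \<open>The block step and its mean contraction\<close>

lemma spectral_sq_le_beta_row:
  assumes "i \<in> {1..s}" "row_block A (I i) \<noteq> 0"
  shows "(onorm ((*v) (row_block A (I i))))\<^sup>2 \<le> beta_row A s I * (norm (row_block A (I i)))\<^sup>2"
proof -
  have "(onorm ((*v) (row_block A (I i))))\<^sup>2 / (norm (row_block A (I i)))\<^sup>2 \<le> beta_row A s I"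
    unfolding beta_row_def using assms(1) by (intro Max_ge) auto
  then show ?thesis using assms(2) by (simp add: divide_le_eq)
qed

lemma beta_row_nonneg:
  assumes "block_partition s I"
  shows "0 \<le> beta_row A s I"
proof -
  obtain i where "i \<in> {1..s}" using assms by (auto simp: block_partition_def)
  then have "(onorm ((*v) (row_block A (I i))))\<^sup>2 / (norm (row_block A (I i)))\<^sup>2 \<le> beta_row A s I"
    unfolding beta_row_def by (intro Max_ge) auto
  moreover have "0 \<le> (onorm ((*v) (row_block A (I i))))\<^sup>2 / (norm (row_block A (I i)))\<^sup>2" by simp
  ultimately show ?thesis by linarith
qed

lemma beta_col_eq: "beta_col A t J = beta_row (transpose A) t J"
  by (simp add: beta_col_def beta_row_def col_block_eq_transpose norm_transpose onorm_transpose)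

lemma rebk_rho_eq: "rebk_rho A t J \<alpha> = rebk_eta (transpose A) t J \<alpha>"
  by (simp add: rebk_rho_def rebk_eta_def beta_col_eq smallest_singular_value_transpose norm_transpose)

text \<open>
  The step of the block Kaczmarz method for the homogeneous system \<open>A v = 0\<close>.
\<close>

definition block_step :: "real^'n^'m \<Rightarrow> real \<Rightarrow> 'm set \<Rightarrow> real^'n \<Rightarrow> real^'n" where
  "block_step A \<alpha> S v =
     v - (\<alpha> / (norm (row_block A S))\<^sup>2) *\<^sub>R (transpose (row_block A S) *v (row_block A S *v v))"

lemma block_step_in_row_space:
  assumes "v \<in> col_space (transpose A)"
  shows "block_step A \<alpha> S v \<in> col_space (transpose A)"
  unfolding block_step_def transpose_row_block_mult_vec
  by (intro subspace_diff[OF subspace_col_space] subspace_scale[OF subspace_col_space]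
      assms mult_vec_in_col_space)

text \<open>
  Scaling by \<open>\<parallel>R\<parallel>\<^sub>F\<^sup>2\<close>, which up to the factor \<open>\<parallel>A\<parallel>\<^sub>F\<^sup>2\<close> is the probability of picking the
  block, makes the coefficient of \<open>\<parallel>R v\<parallel>\<^sup>2\<close> the same for all blocks, so that the bounds can be
  summed.
\<close>

lemma norm_block_step_le:
  fixes A :: "real^'n^'m"
  assumes "row_block A S \<noteq> 0" and \<beta>: "(onorm ((*v) (row_block A S)))\<^sup>2 \<le> \<beta> * (norm (row_block A S))\<^sup>2"
  shows "(norm (row_block A S))\<^sup>2 * (norm (block_step A \<alpha> S v))\<^sup>2
    \<le> (norm (row_block A S))\<^sup>2 * (norm v)\<^sup>2 - (2 * \<alpha> - \<alpha>\<^sup>2 * \<beta>) * (norm (subvec (A *v v) S))\<^sup>2"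
proof -
  define R where "R = row_block A S"
  define f where "f = (norm R)\<^sup>2"
  have f: "0 < f" using assms(1) by (simp add: f_def R_def)
  define c where "c = \<alpha> / f"
  define w where "w = transpose R *v (R *v v)"
  have vw: "v \<bullet> w = (norm (R *v v))\<^sup>2"
    unfolding w_def by (simp add: power2_norm_eq_inner flip: inner_matrix_transpose)
  have "(norm w)\<^sup>2 \<le> (onorm ((*v) R) * norm (R *v v))\<^sup>2"
    unfolding w_def by (intro power_mono norm_transpose_mult_vec_le) auto
  also have "\<dots> \<le> \<beta> * f * (norm (R *v v))\<^sup>2"
    unfolding power_mult_distrib using \<beta> by (intro mult_right_mono) (auto simp: R_def f_def)
  finally have w: "(norm w)\<^sup>2 \<le> \<beta> * f * (norm (R *v v))\<^sup>2" .
  have "(norm (block_step A \<alpha> S v))\<^sup>2 = (norm v)\<^sup>2 - 2 * c * (norm (R *v v))\<^sup>2 + c\<^sup>2 * (norm w)\<^sup>2"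
    unfolding vw[symmetric] norm_sq_diff_scaleR[symmetric]
    by (simp add: block_step_def c_def f_def R_def w_def)
  also have "\<dots> \<le> (norm v)\<^sup>2 - 2 * c * (norm (R *v v))\<^sup>2 + c\<^sup>2 * (\<beta> * f * (norm (R *v v))\<^sup>2)"
    by (intro add_left_mono mult_left_mono w) auto
  finally have "f * (norm (block_step A \<alpha> S v))\<^sup>2
    \<le> f * ((norm v)\<^sup>2 - 2 * c * (norm (R *v v))\<^sup>2 + c\<^sup>2 * (\<beta> * f * (norm (R *v v))\<^sup>2))"
    using f by (intro mult_left_mono) auto
  also have "\<dots> = f * (norm v)\<^sup>2 - (2 * \<alpha> - \<alpha>\<^sup>2 * \<beta>) * (norm (R *v v))\<^sup>2"
    using f by (simp add: c_def field_simps power2_eq_square)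
  finally show ?thesis by (simp add: f_def R_def row_block_mult_vec)
qed

text \<open>
  Summing the bounds for the single blocks reassembles \<open>\<parallel>A\<parallel>\<^sub>F\<^sup>2\<close> and \<open>\<parallel>A v\<parallel>\<^sup>2\<close>; the loss
  \<open>\<parallel>A v\<parallel>\<^sup>2\<close> is at least \<open>\<sigma>\<^sub>r\<^sup>2 \<parallel>v\<parallel>\<^sup>2\<close> on the row space.
\<close>

lemma block_step_contraction:
  fixes A :: "real^'n^'m"
  assumes A: "A \<noteq> 0" and part: "block_partition s I"
    and nz: "\<And>i. i \<in> {1..s} \<Longrightarrow> row_block A (I i) \<noteq> 0"
    and step: "0 \<le> 2 * \<alpha> - \<alpha>\<^sup>2 * beta_row A s I"
    and v: "v \<in> col_space (transpose A)"
  shows "(\<Sum>i=1..s. (norm (row_block A (I i)))\<^sup>2 / (norm A)\<^sup>2 * (norm (block_step A \<alpha> (I i) v))\<^sup>2)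
    \<le> rebk_eta A s I \<alpha> * (norm v)\<^sup>2"
proof -
  let ?\<gamma> = "2 * \<alpha> - \<alpha>\<^sup>2 * beta_row A s I"
  let ?F = "\<lambda>i. (norm (row_block A (I i)))\<^sup>2"
  have nA: "0 < (norm A)\<^sup>2" using A by simp
  have "(\<Sum>i=1..s. ?F i * (norm (block_step A \<alpha> (I i) v))\<^sup>2)
    \<le> (\<Sum>i=1..s. ?F i * (norm v)\<^sup>2 - ?\<gamma> * (norm (subvec (A *v v) (I i)))\<^sup>2)"
    by (intro sum_mono norm_block_step_le nz spectral_sq_le_beta_row) auto
  also have "\<dots> = (norm A)\<^sup>2 * (norm v)\<^sup>2 - ?\<gamma> * (norm (A *v v))\<^sup>2"
    by (simp only: sum_subtractf sum_distrib_left[symmetric] sum_distrib_right[symmetric]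
        sum_norm_sq_row_block[OF part] sum_norm_sq_subvec[OF part])
  also have "\<dots> \<le> (norm A)\<^sup>2 * (norm v)\<^sup>2 - ?\<gamma> * ((smallest_singular_value A)\<^sup>2 * (norm v)\<^sup>2)"
    using smallest_singular_value_bound[OF A v] step by (intro diff_left_mono mult_left_mono)
  also have "\<dots> = (norm A)\<^sup>2 * (rebk_eta A s I \<alpha> * (norm v)\<^sup>2)"
    using nA by (simp add: rebk_eta_def field_simps)
  finally have "(\<Sum>i=1..s. ?F i * (norm (block_step A \<alpha> (I i) v))\<^sup>2) / (norm A)\<^sup>2
      \<le> rebk_eta A s I \<alpha> * (norm v)\<^sup>2"
    using nA by (simp add: divide_le_eq mult.commute)
  then show ?thesis by (simp add: sum_divide_distrib)
qed

text \<open>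
  The rate bounds a mean of squares from above at a nonzero vector of the row space.
\<close>

lemma rebk_eta_nonneg:
  fixes A :: "real^'n^'m"
  assumes A: "A \<noteq> 0" and part: "block_partition s I"
    and nz: "\<And>i. i \<in> {1..s} \<Longrightarrow> row_block A (I i) \<noteq> 0"
    and step: "0 \<le> 2 * \<alpha> - \<alpha>\<^sup>2 * beta_row A s I"
  shows "0 \<le> rebk_eta A s I \<alpha>"
proof -
  obtain u where u: "transpose A *v u \<noteq> 0" using transpose_mult_vec_ne_0[OF A] .
  let ?v = "transpose A *v u"
  have "0 \<le> (\<Sum>i=1..s. (norm (row_block A (I i)))\<^sup>2 / (norm A)\<^sup>2 * (norm (block_step A \<alpha> (I i) ?v))\<^sup>2)"
    by (intro sum_nonneg) auto
  also have "\<dots> \<le> rebk_eta A s I \<alpha> * (norm ?v)\<^sup>2"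
    by (intro block_step_contraction assms mult_vec_in_col_space)
  finally show ?thesis using u by (simp add: zero_le_mult_iff)
qed

section \<open>The pseudoinverse solution\<close>

lemma b_perp_eq: "b_perp A b = b - A *v (pinv A *v b)"
  by (simp add: b_perp_def matrix_vector_mult_diff_rdistrib matrix_vector_mul_assoc)

text \<open>
  \<open>A\<^sup>T A A\<^sup>\<dagger> = A\<^sup>T (A A\<^sup>\<dagger>)\<^sup>T = (A A\<^sup>\<dagger> A)\<^sup>T = A\<^sup>T\<close> by the third and the first Penrose condition.
\<close>

lemma transpose_mult_b_perp: "transpose A *v b_perp A b = 0"
proof -
  let ?X = "pinv A"
  have "transpose A ** (A ** ?X) = transpose A ** transpose (A ** ?X)"
    using is_pinv_pinv[of A] by (simp add: is_pinv_def)
  also have "\<dots> = transpose (A ** ?X ** A)" by (rule matrix_transpose_mul[symmetric])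
  also have "A ** ?X ** A = A" using is_pinv_pinv[of A] by (simp add: is_pinv_def)
  finally have "transpose A *v (A *v (?X *v b)) = transpose A *v b"
    by (simp add: matrix_vector_mul_assoc matrix_mul_assoc)
  then show ?thesis by (simp add: b_perp_eq matrix_vector_mult_diff_distrib)
qed

text \<open>
  \<open>A\<^sup>\<dagger> = (A\<^sup>\<dagger> A)\<^sup>T A\<^sup>\<dagger> = A\<^sup>T (A\<^sup>\<dagger>)\<^sup>T A\<^sup>\<dagger>\<close> by the second and the fourth Penrose condition.
\<close>

lemma pinv_mult_vec_in_row_space: "pinv A *v b \<in> col_space (transpose A)"
proof -
  let ?X = "pinv A"
  have "?X = transpose (?X ** A) ** ?X" using is_pinv_pinv[of A] by (simp add: is_pinv_def)
  then have "?X *v b = transpose A *v (transpose ?X *v (?X *v b))"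
    by (metis matrix_transpose_mul matrix_vector_mul_assoc)
  then show ?thesis by (metis mult_vec_in_col_space)
qed

section \<open>The perturbed block step\<close>

text \<open>
  Equivalent to \<open>\<parallel>\<epsilon> x + y\<parallel>\<^sup>2 / \<epsilon> \<ge> 0\<close>.
\<close>

lemma norm_sq_diff_le_weighted:
  fixes x y :: "'b::real_inner"
  assumes "0 < \<epsilon>"
  shows "(norm (x - y))\<^sup>2 \<le> (1 + \<epsilon>) * (norm x)\<^sup>2 + (1 + 1 / \<epsilon>) * (norm y)\<^sup>2"
proof -
  have "0 \<le> (norm (\<epsilon> *\<^sub>R x - (-1) *\<^sub>R y))\<^sup>2 / \<epsilon>" using assms by simp
  also have "\<dots> = \<epsilon> * (norm x)\<^sup>2 + 2 * (x \<bullet> y) + (norm y)\<^sup>2 / \<epsilon>"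
    using assms unfolding norm_sq_diff_scaleR
    by (simp add: field_simps power2_eq_square)
  finally have "- 2 * (x \<bullet> y) \<le> \<epsilon> * (norm x)\<^sup>2 + (norm y)\<^sup>2 / \<epsilon>" by simp
  moreover have "(norm (x - y))\<^sup>2 = (norm x)\<^sup>2 - 2 * (x \<bullet> y) + (norm y)\<^sup>2"
    using norm_sq_diff_scaleR[of x 1 y] by simp
  ultimately show ?thesis by (simp add: algebra_simps)
qed

text \<open>
  One factor \<open>1 / \<parallel>R\<parallel>\<^sub>F\<^sup>2\<close> of the squared step size is cancelled by the probability of the
  block, the other by \<open>\<parallel>R\<^sup>T w\<parallel>\<^sup>2 \<le> \<beta> \<parallel>R\<parallel>\<^sub>F\<^sup>2 \<parallel>w\<parallel>\<^sup>2\<close>; the pieces \<open>u\<^sub>I\<close> add up to \<open>u\<close>.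
\<close>

lemma expected_noise_le:
  fixes A :: "real^'n^'m"
  assumes part: "block_partition s I"
    and nz: "\<And>i. i \<in> {1..s} \<Longrightarrow> row_block A (I i) \<noteq> 0"
  shows "(\<Sum>i=1..s. (norm (row_block A (I i)))\<^sup>2 / (norm A)\<^sup>2 *
      (norm ((\<alpha> / (norm (row_block A (I i)))\<^sup>2) *\<^sub>R (transpose A *v subvec u (I i))))\<^sup>2)
    \<le> \<alpha>\<^sup>2 * beta_row A s I * (norm u)\<^sup>2 / (norm A)\<^sup>2"
proof -
  let ?\<beta> = "beta_row A s I"
  have block_le: "(norm R)\<^sup>2 / (norm A)\<^sup>2 * (norm ((\<alpha> / (norm R)\<^sup>2) *\<^sub>R (transpose A *v subvec u (I i))))\<^sup>2
      \<le> \<alpha>\<^sup>2 * ?\<beta> / (norm A)\<^sup>2 * (norm (subvec u (I i)))\<^sup>2"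
    if i: "i \<in> {1..s}" and R: "R = row_block A (I i)" for i R
  proof -
    have f: "0 < (norm R)\<^sup>2" using nz[OF i] R by simp
    \<comment> \<open>On vectors supported in the block, \<open>A\<^sup>T\<close> may be replaced by \<open>R\<^sup>T\<close>, whose norm is controlled by \<open>\<beta>\<close>.\<close>
    have "subvec u (I i) = subvec (subvec u (I i)) (I i)" by (simp add: subvec_def vec_eq_iff)
    then have "transpose A *v subvec u (I i) = transpose R *v subvec u (I i)"
      unfolding R transpose_row_block_mult_vec by simp
    then have "(norm (transpose A *v subvec u (I i)))\<^sup>2 \<le> (onorm ((*v) R) * norm (subvec u (I i)))\<^sup>2"
      by (simp add: power_mono norm_transpose_mult_vec_le)
    also have "\<dots> \<le> ?\<beta> * (norm R)\<^sup>2 * (norm (subvec u (I i)))\<^sup>2"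
      unfolding power_mult_distrib R
      by (intro mult_right_mono spectral_sq_le_beta_row i nz) auto
    finally have le: "(norm (transpose A *v subvec u (I i)))\<^sup>2 \<le> \<dots>" .
    have "(norm R)\<^sup>2 / (norm A)\<^sup>2 * (norm ((\<alpha> / (norm R)\<^sup>2) *\<^sub>R (transpose A *v subvec u (I i))))\<^sup>2
      = \<alpha>\<^sup>2 / ((norm A)\<^sup>2 * (norm R)\<^sup>2) * (norm (transpose A *v subvec u (I i)))\<^sup>2"
      using f by (simp add: power_mult_distrib power_divide field_simps power2_eq_square)
    also have "\<dots> \<le> \<alpha>\<^sup>2 / ((norm A)\<^sup>2 * (norm R)\<^sup>2) * (?\<beta> * (norm R)\<^sup>2 * (norm (subvec u (I i)))\<^sup>2)"
      by (intro mult_left_mono le) auto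
    also have "\<dots> = \<alpha>\<^sup>2 * ?\<beta> / (norm A)\<^sup>2 * (norm (subvec u (I i)))\<^sup>2"
      using f by (simp add: field_simps)
    finally show ?thesis .
  qed
  have "(\<Sum>i=1..s. (norm (row_block A (I i)))\<^sup>2 / (norm A)\<^sup>2 *
      (norm ((\<alpha> / (norm (row_block A (I i)))\<^sup>2) *\<^sub>R (transpose A *v subvec u (I i))))\<^sup>2)
    \<le> (\<Sum>i=1..s. \<alpha>\<^sup>2 * ?\<beta> / (norm A)\<^sup>2 * (norm (subvec u (I i)))\<^sup>2)"
    by (intro sum_mono block_le) auto
  also have "\<dots> = \<alpha>\<^sup>2 * ?\<beta> / (norm A)\<^sup>2 * (norm u)\<^sup>2"
    by (simp only: sum_distrib_left[symmetric] sum_norm_sq_subvec[OF part])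
  finally show ?thesis by simp
qed

lemma noisy_block_step_contraction:
  fixes A :: "real^'n^'m"
  assumes A: "A \<noteq> 0" and part: "block_partition s I"
    and nz: "\<And>i. i \<in> {1..s} \<Longrightarrow> row_block A (I i) \<noteq> 0"
    and step: "0 \<le> 2 * \<alpha> - \<alpha>\<^sup>2 * beta_row A s I"
    and v: "v \<in> col_space (transpose A)" and \<epsilon>: "0 < \<epsilon>"
  shows "(\<Sum>i=1..s. (norm (row_block A (I i)))\<^sup>2 / (norm A)\<^sup>2 * (norm (block_step A \<alpha> (I i) v
      - (\<alpha> / (norm (row_block A (I i)))\<^sup>2) *\<^sub>R (transpose A *v subvec u (I i))))\<^sup>2)
    \<le> (1 + \<epsilon>) * rebk_eta A s I \<alpha> * (norm v)\<^sup>2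
      + (1 + 1 / \<epsilon>) * (\<alpha>\<^sup>2 * beta_row A s I / (norm A)\<^sup>2) * (norm u)\<^sup>2"
proof -
  let ?p = "\<lambda>i. (norm (row_block A (I i)))\<^sup>2 / (norm A)\<^sup>2"
  let ?a = "\<lambda>i. block_step A \<alpha> (I i) v"
  let ?n = "\<lambda>i. (\<alpha> / (norm (row_block A (I i)))\<^sup>2) *\<^sub>R (transpose A *v subvec u (I i))"
  have "(\<Sum>i=1..s. ?p i * (norm (?a i - ?n i))\<^sup>2)
    \<le> (\<Sum>i=1..s. ?p i * ((1 + \<epsilon>) * (norm (?a i))\<^sup>2 + (1 + 1 / \<epsilon>) * (norm (?n i))\<^sup>2))"
    by (intro sum_mono mult_left_mono norm_sq_diff_le_weighted \<epsilon>) auto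
  also have "\<dots> = (1 + \<epsilon>) * (\<Sum>i=1..s. ?p i * (norm (?a i))\<^sup>2)
      + (1 + 1 / \<epsilon>) * (\<Sum>i=1..s. ?p i * (norm (?n i))\<^sup>2)"
    by (simp only: sum_distrib_left distrib_left sum.distrib mult.left_commute)
  also have "\<dots> \<le> (1 + \<epsilon>) * (rebk_eta A s I \<alpha> * (norm v)\<^sup>2)
      + (1 + 1 / \<epsilon>) * (\<alpha>\<^sup>2 * beta_row A s I * (norm u)\<^sup>2 / (norm A)\<^sup>2)"
    using \<epsilon> by (intro add_mono mult_left_mono block_step_contraction expected_noise_le A part nz step v) auto
  finally show ?thesis by (simp add: mult.assoc)
qed

section \<open>Averaging over a fresh pick\<close>

text \<open>
  The total mass 1 on \<open>S\<close> forces \<open>S\<close> to carry the distribution, so values of \<open>f\<close> outside \<open>S\<close>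
  have no influence. For the picks, \<open>S\<close> is the index range of the blocks, which they can leave on
  a null set.
\<close>

lemma nn_integral_discrete:
  assumes "prob_space D" and sets: "sets D = UNIV" and S: "finite S"
    and one: "(\<Sum>j\<in>S. measure D {j}) = 1"
  shows "(\<integral>\<^sup>+x. f x \<partial>D) = (\<Sum>j\<in>S. ennreal (measure D {j}) * f j)"
proof -
  interpret prob_space D by fact
  have "measure D S = 1"
    using one finite_measure_eq_sum_singleton[OF S] sets by simp
  then have ae: "AE x in D. x \<in> S" using sets by (subst (asm) prob_eq_1) auto
  have meas: "g \<in> borel_measurable D" for g :: "'a \<Rightarrow> ennreal"
    using sets sets_eq_imp_space_eq[of D "count_space UNIV"] by (auto simp: measurable_def)
  have "(\<integral>\<^sup>+x. f x \<partial>D) = (\<integral>\<^sup>+x. (\<Sum>j\<in>S. f j * indicator {j} x) \<partial>D)"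
  proof (rule nn_integral_cong_AE)
    show "AE x in D. f x = (\<Sum>j\<in>S. f j * indicator {j} x)"
      using ae
    proof eventually_elim
      case (elim x)
      have "(\<Sum>j\<in>S. f j * indicator {j} x) = (\<Sum>j\<in>S. if j = x then f j else 0)"
        by (intro sum.cong) (auto simp: indicator_def)
      then show ?case using elim S by simp
    qed
  qed
  also have "\<dots> = (\<Sum>j\<in>S. \<integral>\<^sup>+x. f j * indicator {j} x \<partial>D)"
    by (rule nn_integral_sum) (rule meas)
  also have "\<dots> = (\<Sum>j\<in>S. ennreal (measure D {j}) * f j)"
    using sets by (simp add: nn_integral_cmult_indicator emeasure_eq_measure mult.commute)
  finally show ?thesis .
qed

text \<open>
  The conditional expectation argument in integrated form: \<open>H\<close> is a function of the picks with
  index in \<open>K\<close>, and if averaging \<open>f\<close> over the fresh pick \<open>X i\<close> with the past fixed gives at most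
  \<open>g\<close>, then so does taking expectations.
\<close>

lemma (in prob_space) nn_integral_fresh_pick_le:
  fixes X :: "'l \<Rightarrow> 'a \<Rightarrow> nat"
  assumes X: "indep_vars (\<lambda>_. count_space UNIV) X L" and K: "K \<subseteq> L" "i \<in> L" "i \<notin> K"
    and G: "G \<in> measurable (PiM K (\<lambda>_. count_space UNIV)) N"
    and H: "\<And>\<omega>. G (restrict (\<lambda>l. X l \<omega>) K) = H \<omega>"
    and S: "finite S" and one: "(\<Sum>j\<in>S. prob {\<omega> \<in> space M. X i \<omega> = j}) = 1"
    and f [measurable]: "\<And>j. f j \<in> borel_measurable N"
    and le: "\<And>\<omega>. \<omega> \<in> space M \<Longrightarrow>
      (\<Sum>j\<in>S. ennreal (prob {\<omega> \<in> space M. X i \<omega> = j}) * f j (H \<omega>)) \<le> g \<omega>"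
  shows "(\<integral>\<^sup>+\<omega>. f (X i \<omega>) (H \<omega>) \<partial>M) \<le> (\<integral>\<^sup>+\<omega>. g \<omega> \<partial>M)"
proof -
  let ?C = "count_space UNIV :: nat measure"
  let ?PK = "PiM K (\<lambda>_. ?C)" and ?Pi = "PiM {i} (\<lambda>_. ?C)"
  let ?past = "\<lambda>\<omega>. restrict (\<lambda>l. X l \<omega>) K" and ?new = "\<lambda>\<omega>. restrict (\<lambda>l. X l \<omega>) {i}"
  let ?D = "distr M ?C (X i)"
  \<comment> \<open>Past and fresh pick need a common value type, so the pick is represented by a function on a singleton.\<close>
  have "indep_var ?PK ?past ?Pi ?new"
    using K by (intro indep_var_restrict[OF X]) auto
  then have past [measurable]: "?past \<in> measurable M ?PK" and new [measurable]: "?new \<in> measurable M ?Pi"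
    and joint: "distr M ?PK ?past \<Otimes>\<^sub>M distr M ?Pi ?new = distr M (?PK \<Otimes>\<^sub>M ?Pi) (\<lambda>\<omega>. (?past \<omega>, ?new \<omega>))"
    by (auto simp: indep_var_distribution_eq)
  have Xi [measurable]: "X i \<in> measurable M ?C"
    using X K unfolding indep_vars_def by blast
  have coord [measurable]: "(\<lambda>y. y i) \<in> measurable ?Pi ?C"
    by (intro measurable_component_singleton) simp
  note G [measurable]
  interpret new: prob_space "distr M ?Pi ?new" by (rule prob_space_distr) (rule new)
  have D_prob: "prob_space ?D" by (rule prob_space_distr) (rule Xi)
  have D: "measure ?D {j} = prob {\<omega> \<in> space M. X i \<omega> = j}" for j
    by (subst measure_distr) (auto intro!: arg_cong[where f=prob])
  have F [measurable]: "(\<lambda>(h, y). f (y i) (G h)) \<in> borel_measurable (?PK \<Otimes>\<^sub>M ?Pi)"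
    unfolding split_beta
    by (rule measurable_compose_countable[where f="\<lambda>p z. f p (G (fst z))" and g="\<lambda>z. snd z i"]) measurable
  have inner: "(\<integral>\<^sup>+y. f (y i) v \<partial>distr M ?Pi ?new)
      = (\<Sum>j\<in>S. ennreal (prob {\<omega> \<in> space M. X i \<omega> = j}) * f j v)" for v
  proof -
    have "(\<integral>\<^sup>+y. f (y i) v \<partial>distr M ?Pi ?new) = (\<integral>\<^sup>+p. f p v \<partial>?D)"
      by (simp add: nn_integral_distr)
    also have "\<dots> = (\<Sum>j\<in>S. ennreal (measure ?D {j}) * f j v)"
      using one by (intro nn_integral_discrete D_prob S) (simp_all add: D)
    finally show ?thesis by (simp add: D)
  qed
  have "(\<integral>\<^sup>+\<omega>. f (X i \<omega>) (H \<omega>) \<partial>M)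
      = (\<integral>\<^sup>+z. (\<lambda>(h, y). f (y i) (G h)) z \<partial>distr M (?PK \<Otimes>\<^sub>M ?Pi) (\<lambda>\<omega>. (?past \<omega>, ?new \<omega>)))"
    by (subst nn_integral_distr) (auto simp: H)
  also have "\<dots> = (\<integral>\<^sup>+h. \<integral>\<^sup>+y. f (y i) (G h) \<partial>distr M ?Pi ?new \<partial>distr M ?PK ?past)"
    unfolding joint[symmetric] by (subst new.nn_integral_fst[symmetric]) auto
  also have "\<dots> = (\<integral>\<^sup>+\<omega>. (\<Sum>j\<in>S. ennreal (prob {\<omega> \<in> space M. X i \<omega> = j}) * f j (H \<omega>)) \<partial>M)"
    unfolding inner by (subst nn_integral_distr) (auto simp: H)
  also have "\<dots> \<le> (\<integral>\<^sup>+\<omega>. g \<omega> \<partial>M)"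
    using le by (intro nn_integral_mono)
  finally show ?thesis .
qed

section \<open>The iterates as functions of the picks\<close>

text \<open>
  Only the picks made so far enter an iterate; this locates the iterate in the past of the next
  pick.
\<close>

lemma rebk_z_cong:
  assumes "\<And>l. 1 \<le> l \<Longrightarrow> l \<le> k \<Longrightarrow> js l = js' l"
  shows "rebk_z A J \<alpha> z0 js k = rebk_z A J \<alpha> z0 js' k"
  using assms by (induction k) (auto simp: Let_def)

lemma rebk_x_cong:
  assumes "\<And>l. 1 \<le> l \<Longrightarrow> l \<le> k \<Longrightarrow> js l = js' l" "\<And>l. 1 \<le> l \<Longrightarrow> l \<le> k \<Longrightarrow> is l = is' l"
  shows "rebk_x A b I J \<alpha> z0 x0 js is k = rebk_x A b I J \<alpha> z0 x0 js' is' k"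
  using assms
proof (induction k)
  case (Suc k)
  have "rebk_z A J \<alpha> z0 js (Suc k) = rebk_z A J \<alpha> z0 js' (Suc k)"
    using Suc.prems by (intro rebk_z_cong) auto
  moreover have "rebk_x A b I J \<alpha> z0 x0 js is k = rebk_x A b I J \<alpha> z0 x0 js' is' k"
    using Suc by auto
  moreover have "is (Suc k) = is' (Suc k)" using Suc.prems by auto
  ultimately show ?case by (simp only: rebk_x.simps)
qed simp

lemma borel_measurable_mult_vec [measurable]:
  fixes A :: "real^'n^'m"
  assumes "f \<in> borel_measurable N"
  shows "(\<lambda>h. A *v f h) \<in> borel_measurable N"
  using assms
  by (rule measurable_compose)
    (intro borel_measurable_continuous_onI linear_continuous_on matrix_vector_mul_bounded_linear)

text \<open>
  Restriction to a block is a matrix, and so inherits measurability from linear maps.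
\<close>

lemma subvec_eq_mult_vec: "subvec v S = row_block (mat 1) S *v v"
  by (simp add: row_block_mult_vec)

lemma borel_measurable_subvec [measurable]:
  "f \<in> borel_measurable N \<Longrightarrow> (\<lambda>h. subvec (f h) S) \<in> borel_measurable N"
  unfolding subvec_eq_mult_vec by (rule borel_measurable_mult_vec)

lemma borel_measurable_block_step [measurable]:
  assumes [measurable]: "f \<in> borel_measurable N"
  shows "(\<lambda>h. block_step A \<alpha> S (f h)) \<in> borel_measurable N"
  unfolding block_step_def by measurable

lemma borel_measurable_rebk_z:
  assumes "\<And>l. 1 \<le> l \<Longrightarrow> l \<le> k \<Longrightarrow> (\<lambda>h. js h l) \<in> N \<rightarrow>\<^sub>M count_space UNIV"
  shows "(\<lambda>h. rebk_z A J \<alpha> z0 (js h) k) \<in> borel_measurable N"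
  using assms
proof (induction k)
  case (Suc k)
  have [measurable]: "(\<lambda>h. rebk_z A J \<alpha> z0 (js h) k) \<in> borel_measurable N"
    using Suc by auto
  have pick [measurable]: "(\<lambda>h. js h (Suc k)) \<in> N \<rightarrow>\<^sub>M count_space UNIV"
    using Suc.prems by auto
  show ?case unfolding rebk_z.simps Let_def
    by (rule measurable_compose_countable[OF _ pick]) measurable
qed simp

lemma borel_measurable_rebk_x:
  assumes "\<And>l. 1 \<le> l \<Longrightarrow> l \<le> k \<Longrightarrow> (\<lambda>h. js h l) \<in> N \<rightarrow>\<^sub>M count_space UNIV"
    and "\<And>l. 1 \<le> l \<Longrightarrow> l \<le> k \<Longrightarrow> (\<lambda>h. is h l) \<in> N \<rightarrow>\<^sub>M count_space UNIV"
  shows "(\<lambda>h. rebk_x A b I J \<alpha> z0 x0 (js h) (is h) k) \<in> borel_measurable N"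
  using assms
proof (induction k)
  case (Suc k)
  have [measurable]: "(\<lambda>h. rebk_x A b I J \<alpha> z0 x0 (js h) (is h) k) \<in> borel_measurable N"
    using Suc by auto
  have [measurable]: "(\<lambda>h. rebk_z A J \<alpha> z0 (js h) (Suc k)) \<in> borel_measurable N"
    using Suc.prems by (intro borel_measurable_rebk_z) auto
  have pick [measurable]: "(\<lambda>h. is h (Suc k)) \<in> N \<rightarrow>\<^sub>M count_space UNIV"
    using Suc.prems by auto
  show ?case unfolding rebk_x.simps Let_def
    by (rule measurable_compose_countable[OF _ pick]) measurable
qed simp

section \<open>Error recursions\<close>

text \<open>
  The transposed column blocks annihilate \<open>b\<^sub>\<bottom>\<close>, so subtracting it commutes with the step.
\<close>

lemma rebk_z_error_Suc:
  "rebk_z A J \<alpha> z0 js (Suc k) - b_perp A b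
    = block_step (transpose A) \<alpha> (J (js (Suc k))) (rebk_z A J \<alpha> z0 js k - b_perp A b)"
proof -
  have "row_block (transpose A) S *v b_perp A b = 0" for S
    by (simp add: row_block_mult_vec transpose_mult_b_perp subvec_def vec_eq_iff)
  then show ?thesis
    by (simp add: block_step_def Let_def col_block_eq_transpose norm_transpose
        matrix_vector_mult_diff_distrib)
qed

lemma rebk_z_error_in_col_space:
  assumes "z0 - b_perp A b \<in> col_space A"
  shows "rebk_z A J \<alpha> z0 js k - b_perp A b \<in> col_space A"
proof (induction k)
  case (Suc k)
  then show ?case
    unfolding rebk_z_error_Suc using block_step_in_row_space[of _ "transpose A"] by simp
qed (simp add: assms)

text \<open>
  Since \<open>A A\<^sup>\<dagger> b = b - b\<^sub>\<bottom>\<close>, the residual \<open>R x - b\<^sub>I + z\<^sub>I\<close> equals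
  \<open>R (x - A\<^sup>\<dagger> b) + (z - b\<^sub>\<bottom>)\<^sub>I\<close>.
\<close>

lemma rebk_x_error_Suc:
  "rebk_x A b I J \<alpha> z0 x0 js is (Suc k) - pinv A *v b
    = block_step A \<alpha> (I (is (Suc k))) (rebk_x A b I J \<alpha> z0 x0 js is k - pinv A *v b)
      - (\<alpha> / (norm (row_block A (I (is (Suc k)))))\<^sup>2) *\<^sub>R
        (transpose A *v subvec (rebk_z A J \<alpha> z0 js (Suc k) - b_perp A b) (I (is (Suc k))))"
proof -
  let ?S = "I (is (Suc k))" and ?x = "rebk_x A b I J \<alpha> z0 x0 js is k"
    and ?z = "rebk_z A J \<alpha> z0 js (Suc k)" and ?y = "pinv A *v b"
  let ?R = "row_block A ?S"
  have "?R *v ?x - subvec b ?S + subvec ?z ?S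
      = ?R *v (?x - ?y) + subvec (?z - b_perp A b) ?S"
    by (simp add: row_block_mult_vec b_perp_eq matrix_vector_mult_diff_distrib subvec_diff)
  then have "transpose ?R *v (?R *v ?x - subvec b ?S + subvec ?z ?S)
      = transpose ?R *v (?R *v (?x - ?y)) + transpose A *v subvec (?z - b_perp A b) ?S"
    by (simp add: matrix_vector_right_distrib)
      (simp add: transpose_row_block_mult_vec subvec_def if_distrib cong: if_cong)
  then show ?thesis
    unfolding rebk_x.simps Let_def block_step_def by (simp add: scaleR_add_right)
qed

lemma rebk_x_error_in_row_space:
  assumes "x0 \<in> col_space (transpose A)"
  shows "rebk_x A b I J \<alpha> z0 x0 js is k - pinv A *v b \<in> col_space (transpose A)"
proof (induction k)
  case (Suc k)
  then show ?case
    unfolding rebk_x_error_Suc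
    by (intro subspace_diff[OF subspace_col_space block_step_in_row_space]
        subspace_scale[OF subspace_col_space] mult_vec_in_col_space)
qed (simp add: assms subspace_diff[OF subspace_col_space] pinv_mult_vec_in_row_space)

section \<open>Expected errors\<close>

lemma ennreal_weighted_sum:
  assumes "\<And>j. j \<in> S \<Longrightarrow> 0 \<le> p j" "\<And>j. j \<in> S \<Longrightarrow> 0 \<le> f j"
  shows "(\<Sum>j\<in>S. ennreal (p j) * ennreal (f j)) = ennreal (\<Sum>j\<in>S. p j * f j)"
  using assms by (simp add: sum_ennreal ennreal_mult flip: ennreal_mult)

text \<open>
  The column blocks are given as row blocks of \<open>A\<^sup>T\<close>, and the bound on the step size is reduced
  to the sign conditions under which the two contraction estimates hold.
\<close>

locale rebk_run = prob_space M
  for M :: "'w measure" +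
  fixes A :: "real^'n^'m" and b z0 :: "real^'m" and x0 :: "real^'n"
    and I :: "nat \<Rightarrow> 'm set" and J :: "nat \<Rightarrow> 'n set" and s t :: nat
    and \<alpha> :: real and jpick ipick :: "nat \<Rightarrow> 'w \<Rightarrow> nat"
  assumes A: "A \<noteq> 0"
    and I: "block_partition s I" "\<And>i. i \<in> {1..s} \<Longrightarrow> row_block A (I i) \<noteq> 0"
    and J: "block_partition t J" "\<And>j. j \<in> {1..t} \<Longrightarrow> row_block (transpose A) (J j) \<noteq> 0"
    and picks: "rebk_picks M A s I t J jpick ipick"
    and z0: "z0 - b_perp A b \<in> col_space A"
    and x0: "x0 \<in> col_space (transpose A)"
    and step: "0 \<le> 2 * \<alpha> - \<alpha>\<^sup>2 * beta_row A s I"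
      "0 \<le> 2 * \<alpha> - \<alpha>\<^sup>2 * beta_row (transpose A) t J"
begin

abbreviation "\<eta> \<equiv> rebk_eta A s I \<alpha>"
abbreviation "\<rho> \<equiv> rebk_eta (transpose A) t J \<alpha>"
abbreviation "u k \<omega> \<equiv> rebk_z A J \<alpha> z0 (\<lambda>l. jpick l \<omega>) k - b_perp A b"
abbreviation "e k \<omega> \<equiv>
  rebk_x A b I J \<alpha> z0 x0 (\<lambda>l. jpick l \<omega>) (\<lambda>l. ipick l \<omega>) k - pinv A *v b"

lemma transpose_A_nonzero: "transpose A \<noteq> 0"
  using A by (metis norm_eq_zero norm_transpose)

lemma eta_nonneg: "0 \<le> \<eta>"
  by (intro rebk_eta_nonneg A I step)

lemma rho_nonneg: "0 \<le> \<rho>"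
  by (intro rebk_eta_nonneg transpose_A_nonzero J step)

lemma indep: "indep_vars (\<lambda>_. count_space UNIV) (case_sum jpick ipick) ({1..} <+> {1..})"
  using picks by (simp add: rebk_picks_def)

lemma prob_jpick: "j \<in> {1..t} \<Longrightarrow> prob {\<omega> \<in> space M. jpick (Suc k) \<omega> = j}
    = (norm (row_block (transpose A) (J j)))\<^sup>2 / (norm (transpose A))\<^sup>2"
  using picks by (simp add: rebk_picks_def col_block_eq_transpose norm_transpose)

lemma prob_ipick: "i \<in> {1..s} \<Longrightarrow> prob {\<omega> \<in> space M. ipick (Suc k) \<omega> = i}
    = (norm (row_block A (I i)))\<^sup>2 / (norm A)\<^sup>2"
  using picks by (simp add: rebk_picks_def)

lemma sum_prob_jpick: "(\<Sum>j=1..t. prob {\<omega> \<in> space M. jpick (Suc k) \<omega> = j}) = 1"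
proof -
  have "(\<Sum>j=1..t. prob {\<omega> \<in> space M. jpick (Suc k) \<omega> = j})
      = (\<Sum>j=1..t. (norm (row_block (transpose A) (J j)))\<^sup>2 / (norm (transpose A))\<^sup>2)"
    by (intro sum.cong refl prob_jpick)
  then show ?thesis
    using transpose_A_nonzero by (simp only: sum_divide_distrib[symmetric] sum_norm_sq_row_block[OF J(1)]) simp
qed

lemma sum_prob_ipick: "(\<Sum>i=1..s. prob {\<omega> \<in> space M. ipick (Suc k) \<omega> = i}) = 1"
proof -
  have "(\<Sum>i=1..s. prob {\<omega> \<in> space M. ipick (Suc k) \<omega> = i})
      = (\<Sum>i=1..s. (norm (row_block A (I i)))\<^sup>2 / (norm A)\<^sup>2)"
    by (intro sum.cong refl prob_ipick)
  then show ?thesis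
    using A by (simp only: sum_divide_distrib[symmetric] sum_norm_sq_row_block[OF I(1)]) simp
qed

lemma measurable_pick:
  assumes "1 \<le> l"
  shows "jpick l \<in> M \<rightarrow>\<^sub>M count_space UNIV" "ipick l \<in> M \<rightarrow>\<^sub>M count_space UNIV"
proof -
  have "case_sum jpick ipick c \<in> M \<rightarrow>\<^sub>M count_space UNIV" if "c \<in> {1..} <+> {1..}" for c
    using indep that unfolding indep_vars_def by blast
  from this[of "Inl l"] this[of "Inr l"] assms
  show "jpick l \<in> M \<rightarrow>\<^sub>M count_space UNIV" "ipick l \<in> M \<rightarrow>\<^sub>M count_space UNIV" by auto
qed

lemma measurable_u [measurable]: "u k \<in> borel_measurable M"
  by (intro borel_measurable_diff borel_measurable_const borel_measurable_rebk_z measurable_pick)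

lemma measurable_e [measurable]: "e k \<in> borel_measurable M"
  by (intro borel_measurable_diff borel_measurable_const borel_measurable_rebk_x measurable_pick)

abbreviation "pick_history \<equiv> (\<lambda>K \<omega>. restrict (\<lambda>l. case_sum jpick ipick l \<omega>) K)"

lemma u_from_history:
  obtains G where "G \<in> borel_measurable (PiM ({1..k} <+> {}) (\<lambda>_. count_space UNIV))"
    "\<And>\<omega>. G (pick_history ({1..k} <+> {}) \<omega>) = u k \<omega>"
proof
  let ?K = "{1..k} <+> {} :: (nat + nat) set"
  let ?G = "\<lambda>h. rebk_z A J \<alpha> z0 (\<lambda>l. h (Inl l)) k - b_perp A b"
  show "?G \<in> borel_measurable (PiM ?K (\<lambda>_. count_space UNIV))"
    by (intro borel_measurable_diff borel_measurable_const borel_measurable_rebk_z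
        measurable_component_singleton) auto
  show "?G (pick_history ?K \<omega>) = u k \<omega>" for \<omega>
    by (intro arg_cong2[where f=minus] rebk_z_cong refl) auto
qed

lemma e_u_from_history:
  obtains G where "G \<in> PiM ({1..Suc k} <+> {1..k}) (\<lambda>_. count_space UNIV) \<rightarrow>\<^sub>M borel \<Otimes>\<^sub>M borel"
    "\<And>\<omega>. G (pick_history ({1..Suc k} <+> {1..k}) \<omega>) = (e k \<omega>, u (Suc k) \<omega>)"
proof
  let ?K = "{1..Suc k} <+> {1..k} :: (nat + nat) set"
  let ?G = "\<lambda>h. (rebk_x A b I J \<alpha> z0 x0 (\<lambda>l. h (Inl l)) (\<lambda>l. h (Inr l)) k - pinv A *v b,
    rebk_z A J \<alpha> z0 (\<lambda>l. h (Inl l)) (Suc k) - b_perp A b)"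
  show "?G \<in> PiM ?K (\<lambda>_. count_space UNIV) \<rightarrow>\<^sub>M borel \<Otimes>\<^sub>M borel"
    by (intro measurable_Pair borel_measurable_diff borel_measurable_const borel_measurable_rebk_z
        borel_measurable_rebk_x measurable_component_singleton) auto
  show "?G (pick_history ?K \<omega>) = (e k \<omega>, u (Suc k) \<omega>)" for \<omega>
    by (intro arg_cong2[where f=Pair] arg_cong2[where f=minus] rebk_z_cong rebk_x_cong refl) auto
qed

text \<open>
  The pick of a column block in iteration \<open>k + 1\<close> is fresh for \<open>u\<^sub>k\<close>, which depends on the
  column picks \<open>1, \<dots>, k\<close> only.
\<close>

lemma nn_integral_jpick_le:
  assumes f: "\<And>j. f j \<in> borel_measurable borel"
    and le: "\<And>\<omega>. (\<Sum>j=1..t. ennreal (prob {\<omega> \<in> space M. jpick (Suc k) \<omega> = j}) * f j (u k \<omega>)) \<le> g \<omega>"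
  shows "(\<integral>\<^sup>+\<omega>. f (jpick (Suc k) \<omega>) (u k \<omega>) \<partial>M) \<le> (\<integral>\<^sup>+\<omega>. g \<omega> \<partial>M)"
proof -
  obtain G where G: "G \<in> borel_measurable (PiM ({1..k} <+> {}) (\<lambda>_. count_space UNIV))"
    "\<And>\<omega>. G (pick_history ({1..k} <+> {}) \<omega>) = u k \<omega>"
    using u_from_history[where k = k] by blast
  show ?thesis
    using nn_integral_fresh_pick_le[OF indep _ _ _ G, where i="Inl (Suc k)" and S="{1..t}" and f=f and g=g]
      sum_prob_jpick f le by fastforce
qed

text \<open>
  The pick of a row block comes after the pick of a column block in the same iteration. It is
  therefore fresh for the pair of \<open>e\<^sub>k\<close> and the already updated \<open>u\<^sub>k\<^sub>+\<^sub>1\<close>.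
\<close>

lemma nn_integral_ipick_le:
  assumes f: "\<And>i. f i \<in> borel_measurable (borel \<Otimes>\<^sub>M borel)"
    and le: "\<And>\<omega>. (\<Sum>i=1..s. ennreal (prob {\<omega> \<in> space M. ipick (Suc k) \<omega> = i})
      * f i (e k \<omega>, u (Suc k) \<omega>)) \<le> g \<omega>"
  shows "(\<integral>\<^sup>+\<omega>. f (ipick (Suc k) \<omega>) (e k \<omega>, u (Suc k) \<omega>) \<partial>M) \<le> (\<integral>\<^sup>+\<omega>. g \<omega> \<partial>M)"
proof -
  obtain G where G: "G \<in> PiM ({1..Suc k} <+> {1..k}) (\<lambda>_. count_space UNIV) \<rightarrow>\<^sub>M borel \<Otimes>\<^sub>M borel"
    "\<And>\<omega>. G (pick_history ({1..Suc k} <+> {1..k}) \<omega>) = (e k \<omega>, u (Suc k) \<omega>)"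
    using e_u_from_history[where k = k] by blast
  show ?thesis
    using nn_integral_fresh_pick_le[OF indep _ _ _ G, where i="Inr (Suc k)" and S="{1..s}" and f=f and g=g]
      sum_prob_ipick f le by fastforce
qed

lemma nn_integral_u_le:
  "(\<integral>\<^sup>+\<omega>. ennreal ((norm (u k \<omega>))\<^sup>2) \<partial>M) \<le> ennreal (\<rho> ^ k * (norm (z0 - b_perp A b))\<^sup>2)"
proof (induction k)
  case 0
  then show ?case by (simp add: emeasure_space_1)
next
  case (Suc k)
  let ?B = "transpose A"
  have "(\<integral>\<^sup>+\<omega>. ennreal ((norm (u (Suc k) \<omega>))\<^sup>2) \<partial>M)
      = (\<integral>\<^sup>+\<omega>. ennreal ((norm (block_step ?B \<alpha> (J (jpick (Suc k) \<omega>)) (u k \<omega>)))\<^sup>2) \<partial>M)"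
    by (simp only: rebk_z_error_Suc)
  also have "\<dots> \<le> (\<integral>\<^sup>+\<omega>. ennreal (\<rho> * (norm (u k \<omega>))\<^sup>2) \<partial>M)"
  proof (rule nn_integral_jpick_le[where f="\<lambda>j v. ennreal ((norm (block_step ?B \<alpha> (J j) v))\<^sup>2)"])
    fix \<omega>
    have uW: "u k \<omega> \<in> col_space (transpose ?B)" using rebk_z_error_in_col_space[OF z0] by simp
    have "(\<Sum>j=1..t. prob {\<omega> \<in> space M. jpick (Suc k) \<omega> = j} * (norm (block_step ?B \<alpha> (J j) (u k \<omega>)))\<^sup>2)
      \<le> \<rho> * (norm (u k \<omega>))\<^sup>2"
      using block_step_contraction[OF transpose_A_nonzero J step(2) uW] by (simp add: prob_jpick)
    then show "(\<Sum>j=1..t. ennreal (prob {\<omega> \<in> space M. jpick (Suc k) \<omega> = j}) *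
        ennreal ((norm (block_step ?B \<alpha> (J j) (u k \<omega>)))\<^sup>2)) \<le> ennreal (\<rho> * (norm (u k \<omega>))\<^sup>2)"
      by (subst ennreal_weighted_sum) (auto intro: ennreal_leI)
  qed auto
  also have "\<dots> = ennreal \<rho> * (\<integral>\<^sup>+\<omega>. ennreal ((norm (u k \<omega>))\<^sup>2) \<partial>M)"
    by (simp add: ennreal_mult rho_nonneg nn_integral_cmult)
  also have "\<dots> \<le> ennreal \<rho> * ennreal (\<rho> ^ k * (norm (z0 - b_perp A b))\<^sup>2)"
    by (intro mult_left_mono Suc.IH) auto
  also have "\<dots> = ennreal (\<rho> ^ Suc k * (norm (z0 - b_perp A b))\<^sup>2)"
    using rho_nonneg by (simp add: mult.assoc flip: ennreal_mult)
  finally show ?case .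
qed

text \<open>
  The bound \<open>B\<^sub>k\<close> solves \<open>B\<^sub>k\<^sub>+\<^sub>1 = g B\<^sub>k + c \<rho>\<^sup>k\<^sup>+\<^sup>1 \<parallel>u\<^sub>0\<parallel>\<^sup>2\<close>: in the sum, the new noise is the
  summand \<open>l = 0\<close>, and the older ones are shifted by one factor \<open>g\<close>.
\<close>

lemma nn_integral_e_le:
  fixes \<epsilon> :: real
  assumes \<epsilon>: "0 < \<epsilon>"
  defines "g \<equiv> (1 + \<epsilon>) * \<eta>"
    and "c \<equiv> (1 + 1 / \<epsilon>) * (\<alpha>\<^sup>2 * beta_row A s I / (norm A)\<^sup>2)"
  shows "(\<integral>\<^sup>+\<omega>. ennreal ((norm (e k \<omega>))\<^sup>2) \<partial>M)
    \<le> ennreal (g ^ k * (norm (x0 - pinv A *v b))\<^sup>2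
        + c * (norm (z0 - b_perp A b))\<^sup>2 * (\<Sum>l<k. \<rho> ^ (k - l) * g ^ l))"
proof (induction k)
  case 0
  then show ?case by (simp add: emeasure_space_1)
next
  case (Suc k)
  have g: "0 \<le> g" using \<epsilon> eta_nonneg by (simp add: g_def)
  have c: "0 \<le> c" unfolding c_def using \<epsilon>
    by (intro mult_nonneg_nonneg divide_nonneg_nonneg beta_row_nonneg I(1)) auto
  let ?E = "(norm (x0 - pinv A *v b))\<^sup>2" and ?U = "(norm (z0 - b_perp A b))\<^sup>2"
  let ?R = "g ^ k * ?E + c * ?U * (\<Sum>l<k. \<rho> ^ (k - l) * g ^ l)"
  have R: "0 \<le> ?R"
    using g c rho_nonneg by (intro add_nonneg_nonneg mult_nonneg_nonneg sum_nonneg) auto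
  let ?next = "\<lambda>i (v, w). block_step A \<alpha> (I i) v
      - (\<alpha> / (norm (row_block A (I i)))\<^sup>2) *\<^sub>R (transpose A *v subvec w (I i))"
  have "(\<integral>\<^sup>+\<omega>. ennreal ((norm (e (Suc k) \<omega>))\<^sup>2) \<partial>M)
      = (\<integral>\<^sup>+\<omega>. ennreal ((norm (?next (ipick (Suc k) \<omega>) (e k \<omega>, u (Suc k) \<omega>)))\<^sup>2) \<partial>M)"
    by (simp only: rebk_x_error_Suc prod.case)
  also have "\<dots> \<le> (\<integral>\<^sup>+\<omega>. ennreal (g * (norm (e k \<omega>))\<^sup>2 + c * (norm (u (Suc k) \<omega>))\<^sup>2) \<partial>M)"
  proof (rule nn_integral_ipick_le[where f="\<lambda>i y. ennreal ((norm (?next i y))\<^sup>2)"])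
    show "(\<lambda>y. ennreal ((norm (?next i y))\<^sup>2)) \<in> borel_measurable (borel \<Otimes>\<^sub>M borel)" for i
      unfolding split_beta by measurable
  next
    fix \<omega>
    have "(\<Sum>i=1..s. prob {\<omega> \<in> space M. ipick (Suc k) \<omega> = i} *
        (norm (?next i (e k \<omega>, u (Suc k) \<omega>)))\<^sup>2)
      \<le> g * (norm (e k \<omega>))\<^sup>2 + c * (norm (u (Suc k) \<omega>))\<^sup>2"
      using noisy_block_step_contraction[OF A I step(1) rebk_x_error_in_row_space[OF x0] \<epsilon>]
      by (simp only: prob_ipick g_def c_def prod.case cong: sum.cong)
    then show "(\<Sum>i=1..s. ennreal (prob {\<omega> \<in> space M. ipick (Suc k) \<omega> = i}) *
        ennreal ((norm (?next i (e k \<omega>, u (Suc k) \<omega>)))\<^sup>2))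
      \<le> ennreal (g * (norm (e k \<omega>))\<^sup>2 + c * (norm (u (Suc k) \<omega>))\<^sup>2)"
      by (subst ennreal_weighted_sum) (auto intro: ennreal_leI)
  qed
  also have "\<dots> = ennreal g * (\<integral>\<^sup>+\<omega>. ennreal ((norm (e k \<omega>))\<^sup>2) \<partial>M)
      + ennreal c * (\<integral>\<^sup>+\<omega>. ennreal ((norm (u (Suc k) \<omega>))\<^sup>2) \<partial>M)"
    using g c by (simp add: ennreal_mult nn_integral_cmult nn_integral_add del: rebk_z.simps)
  also have "\<dots> \<le> ennreal g * ennreal ?R + ennreal c * ennreal (\<rho> ^ Suc k * ?U)"
    by (intro add_mono mult_left_mono Suc.IH nn_integral_u_le) auto
  also have "\<dots> = ennreal (g * ?R + c * (\<rho> ^ Suc k * ?U))"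
    using g c R rho_nonneg by (simp add: ennreal_mult)
  also have "g * ?R + c * (\<rho> ^ Suc k * ?U)
      = g ^ Suc k * ?E + c * ?U * (\<Sum>l<Suc k. \<rho> ^ (Suc k - l) * g ^ l)"
    unfolding sum.lessThan_Suc_shift by (simp add: algebra_simps sum_distrib_left)
  finally show ?case .
qed

end

theorem theorem7:
  fixes A :: "real^'n^'m" and b z0 :: "real^'m" and x0 :: "real^'n"
    and I :: "nat \<Rightarrow> 'm set" and J :: "nat \<Rightarrow> 'n set" and s t k :: nat
    and \<alpha> \<epsilon> :: real
    and M :: "'w measure" and jpick ipick :: "nat \<Rightarrow> 'w \<Rightarrow> nat"
  assumes "A \<noteq> 0"
    and "block_partition s I" and "\<And>i. i \<in> {1..s} \<Longrightarrow> row_block A (I i) \<noteq> 0"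
    and "block_partition t J" and "\<And>j. j \<in> {1..t} \<Longrightarrow> col_block A (J j) \<noteq> 0"
    and "prob_space M" and "rebk_picks M A s I t J jpick ipick"
    and "\<exists>w \<in> col_space A. z0 = b + w"
    and "x0 \<in> col_space (transpose A)"
    and "0 < \<alpha>" and "\<alpha> < 2 / max (beta_row A s I) (beta_col A t J)"
    and "\<epsilon> > 0"
  shows "prob_space.expectation M
           (\<lambda>\<omega>. (norm (rebk_x A b I J \<alpha> z0 x0 (\<lambda>l. jpick l \<omega>) (\<lambda>l. ipick l \<omega>) k - pinv A *v b))\<^sup>2)
         \<le> (1 + \<epsilon>) ^ k * rebk_eta A s I \<alpha> ^ k * (norm (x0 - pinv A *v b))\<^sup>2
           + (1 + 1 / \<epsilon>) * (\<alpha>\<^sup>2 * beta_row A s I * (norm (z0 - b_perp A b))\<^sup>2 / (frobenius_norm A)\<^sup>2)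
             * (\<Sum>l<k. rebk_rho A t J \<alpha> ^ (k - l) * (1 + \<epsilon>) ^ l * rebk_eta A s I \<alpha> ^ l)"
proof -
  let ?m = "max (beta_row A s I) (beta_col A t J)"
  \<comment> \<open>A nonpositive maximum would make the upper bound \<open>2 / ?m\<close> for the positive \<open>\<alpha>\<close> nonpositive.\<close>
  have "0 < ?m"
  proof (rule ccontr)
    assume "\<not> 0 < ?m"
    then have "2 / ?m \<le> 0" by (intro divide_nonneg_nonpos) (simp_all only: not_less zero_le_numeral)
    with assms show False by linarith
  qed
  then have "\<alpha> * ?m \<le> 2" using assms(11) by (simp add: field_simps)
  have step: "0 \<le> 2 * \<alpha> - \<alpha>\<^sup>2 * \<beta>" if "\<beta> \<le> ?m" for \<beta>
  proof -
    have "\<alpha> * \<beta> \<le> 2" using that \<open>0 < \<alpha>\<close> \<open>\<alpha> * ?m \<le> 2\<close> by (meson mult_left_mono less_imp_le order_trans)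
    then have "\<alpha> * (\<alpha> * \<beta>) \<le> \<alpha> * 2" using \<open>0 < \<alpha>\<close> by (intro mult_left_mono) auto
    then show ?thesis by (simp add: power2_eq_square ac_simps)
  qed
  have z0: "z0 - b_perp A b \<in> col_space A"
  proof -
    obtain w where "w \<in> col_space A" "z0 = b + w" using assms(8) by blast
    moreover from this have "z0 - b_perp A b = w + A *v (pinv A *v b)" by (simp add: b_perp_eq)
    ultimately show ?thesis
      by (simp only: subspace_add[OF subspace_col_space] mult_vec_in_col_space)
  qed
  interpret rebk_run M A b z0 x0 I J s t \<alpha> jpick ipick
  proof (intro rebk_run.intro rebk_run_axioms.intro)
    show "row_block (transpose A) (J j) \<noteq> 0" if "j \<in> {1..t}" for j
      using assms(5)[OF that] norm_transpose[of "row_block (transpose A) (J j)"]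
      by (metis col_block_eq_transpose norm_eq_zero)
    show "0 \<le> 2 * \<alpha> - \<alpha>\<^sup>2 * beta_row A s I" "0 \<le> 2 * \<alpha> - \<alpha>\<^sup>2 * beta_row (transpose A) t J"
      by (intro step; simp add: beta_col_eq)+
  qed (fact assms z0)+
  let ?g = "(1 + \<epsilon>) * \<eta>"
    and ?c = "(1 + 1 / \<epsilon>) * (\<alpha>\<^sup>2 * beta_row A s I / (norm A)\<^sup>2)"
  have nonneg: "0 \<le> ?g ^ k * (norm (x0 - pinv A *v b))\<^sup>2
      + ?c * (norm (z0 - b_perp A b))\<^sup>2 * (\<Sum>l<k. \<rho> ^ (k - l) * ?g ^ l)"
    using \<open>\<epsilon> > 0\<close> \<open>0 < \<alpha>\<close> eta_nonneg rho_nonneg beta_row_nonneg[OF assms(2)]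
    by (intro add_nonneg_nonneg mult_nonneg_nonneg sum_nonneg zero_le_power divide_nonneg_nonneg) auto
  have "expectation (\<lambda>\<omega>. (norm (e k \<omega>))\<^sup>2)
    \<le> ?g ^ k * (norm (x0 - pinv A *v b))\<^sup>2
      + ?c * (norm (z0 - b_perp A b))\<^sup>2 * (\<Sum>l<k. \<rho> ^ (k - l) * ?g ^ l)"
    by (rule integral_real_bounded[OF nonneg nn_integral_e_le[OF \<open>\<epsilon> > 0\<close>]])
  then show ?thesis by (simp add: rebk_rho_eq power_mult_distrib mult.assoc)
qed

end
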